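(* Let $n \geq 2$, $0<p<n$, and let $K \subset \mathbb{R}^n$ be a compact set with positive $p$-capacity, $C_p(K)>0$. Let $M$ be a real, invertible $n \times n$ matrix with $\lVert M^{-1} \rVert_{p,n} = 1$, and suppose $K$ has an irreducible group of isometries. Then \[ C_p(MK) \geq C_p(K), \] with equality if and only if $M$ is orthogonal.
   Context: The Riesz $p$-energy of a compact set $K \subset \mathbb{R}^n$, for $0<p<n$, is \[ V_p(K) = \min_\mu \int_K \int_K \frac{1}{|x-y|^p} \, d\mu(x)\, d\mu(y) \in (0,+\infty], \] where the minimum is over all Borel probability measures $\mu$ on $K$ (the minimum is attained). The $p$-capacity is $C_p(K) = V_p(K)^{-1/p}$, with value $0$ when $V_p(K)=+\infty$. For a real $n \times n$ matrix $A$ with singular values $\sigma_1(A),\dots,\sigma_n(A)$, the normalized (Schatten) $p$-norm is \[ \lVert A \rVert_{p,n} = \left( \frac{1}{n} \sum_{k=1}^n \sigma_k(A)^p \right)^{1/p}. \] An isometry of a set $K \subset \mathbb{R}^n$ is an orthogonal $n \times n$ matrix $U$ with $UK=K$. A group $\mathcal{U}$ of orthogonal $n\times n$ matrices is irreducible if the only subspaces of $\mathbb{R}^n$ invariant under the action of the group are $\{0\}$ and $\mathbb{R}^n$; equivalently, $\{Ux : U \in \mathcal{U}\}$ spans $\mathbb{R}^n$ for every nonzero $x \in \mathbb{R}^n$. Also $MK=\{Mx : x\in K\}$. *)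

theory Defs
  imports "HOL-Analysis.Analysis" "HOL-Computational_Algebra.Computational_Algebra"
begin

section \<open>Riesz energy and capacity\<close>

text \<open>
  Division is that of \<^typ>\<open>ennreal\<close>, where \<open>1 / 0 = \<infinity>\<close>; hence the kernel is
  infinite on the diagonal.
\<close>
definition riesz_kernel :: "real \<Rightarrow> 'a::real_normed_vector \<Rightarrow> 'a \<Rightarrow> ennreal" where
  "riesz_kernel p x y = 1 / ennreal (norm (x - y) powr p)"

lemma riesz_kernel_diagonal: "riesz_kernel p x x = \<infinity>"
  by (simp add: riesz_kernel_def ennreal_divide_zero)

lemma riesz_kernel_off_diagonal:
  "x \<noteq> y \<Longrightarrow> riesz_kernel p x y = ennreal (1 / norm (x - y) powr p)"
  by (simp add: riesz_kernel_def divide_ennreal flip: ennreal_1)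

definition borel_prob_measures_on :: "'a::topological_space set \<Rightarrow> 'a measure set" where
  "borel_prob_measures_on K = {\<mu>. sets \<mu> = sets (restrict_space borel K) \<and> emeasure \<mu> K = 1}"

text \<open>
  For nonempty compact \<open>K\<close> the infimum is attained, so it is the minimum; for \<open>K = {}\<close> there is
  no probability measure on \<open>K\<close> and the energy is \<open>\<infinity>\<close>.
\<close>
definition riesz_energy :: "real \<Rightarrow> 'a::real_normed_vector set \<Rightarrow> ennreal" where
  "riesz_energy p K =
     (INF \<mu>\<in>borel_prob_measures_on K. \<integral>\<^sup>+ y. (\<integral>\<^sup>+ x. riesz_kernel p x y \<partial>\<mu>) \<partial>\<mu>)"

definition riesz_capacity :: "real \<Rightarrow> 'a::real_normed_vector set \<Rightarrow> real" where
  "riesz_capacity p K =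
     (if riesz_energy p K = \<infinity> then 0 else enn2real (riesz_energy p K) powr (- 1 / p))"


section \<open>Singular values and the normalized Schatten norm\<close>

definition charpoly :: "real ^ 'n ^ 'n \<Rightarrow> real poly" where
  "charpoly A = det (mat [:0, 1:] - (\<chi> i j. [:A $ i $ j:]) :: real poly ^ 'n ^ 'n)"

text \<open>
  The square roots of the eigenvalues of \<open>A\<^sup>T A\<close>, with algebraic multiplicity. As \<open>A\<^sup>T A\<close> is
  positive semidefinite, its characteristic polynomial splits over the reals with nonnegative
  roots, so there are \<open>n\<close> of them.
\<close>
definition singular_values :: "real ^ 'n ^ 'n \<Rightarrow> real multiset" where
  "singular_values A = image_mset sqrt (proots (charpoly (transpose A ** A)))"

definition normalized_schatten_norm :: "real \<Rightarrow> real ^ 'n ^ 'n \<Rightarrow> real" where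
  "normalized_schatten_norm p A =
     (1 / real CARD('n) * (\<Sum>\<sigma>\<in>#singular_values A. \<sigma> powr p)) powr (1 / p)"


section \<open>Irreducible groups of isometries\<close>

definition orthogonal_matrix_group :: "(real ^ 'n ^ 'n) set \<Rightarrow> bool" where
  "orthogonal_matrix_group \<U> \<longleftrightarrow>
     (\<forall>U\<in>\<U>. orthogonal_matrix U) \<and> mat 1 \<in> \<U> \<and>
     (\<forall>U\<in>\<U>. \<forall>V\<in>\<U>. U ** V \<in> \<U>) \<and> (\<forall>U\<in>\<U>. matrix_inv U \<in> \<U>)"

definition irreducible_matrix_group :: "(real ^ 'n ^ 'n) set \<Rightarrow> bool" where
  "irreducible_matrix_group \<U> \<longleftrightarrow>
     orthogonal_matrix_group \<U> \<and>
     (\<forall>S. subspace S \<and> (\<forall>U\<in>\<U>. (\<lambda>x. U *v x) ` S \<subseteq> S) \<longrightarrow> S = {0} \<or> S = UNIV)"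

definition isometry_of :: "(real ^ 'n) set \<Rightarrow> real ^ 'n ^ 'n \<Rightarrow> bool" where
  "isometry_of K U \<longleftrightarrow> orthogonal_matrix U \<and> (\<lambda>x. U *v x) ` K = K"

definition has_irreducible_isometry_group :: "(real ^ 'n) set \<Rightarrow> bool" where
  "has_irreducible_isometry_group K \<longleftrightarrow>
     (\<exists>\<U>. irreducible_matrix_group \<U> \<and> (\<forall>U\<in>\<U>. isometry_of K U))"

end

theory Submission
  imports Defs "HOL-Probability.Distributions"
begin

text \<open>
  Push a probability measure on \<open>K\<close> forward by \<open>M U\<close> for an isometry \<open>U\<close> of \<open>K\<close>. Writing \<open>|M z|\<^sup>2\<close>
  in terms of the singular values \<open>\<sigma>\<^sub>i\<close> of the inverse of \<open>M\<close>, Jensen's inequality bounds \<open>|M z|\<close>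
  to the power \<open>-p\<close> by \<open>|z|\<close> to the power \<open>-p-2\<close> times a quadratic form with eigenvalues
  \<open>q\<^sub>i\<close>, the \<open>p\<close>-th powers of the \<open>\<sigma>\<^sub>i\<close>. By irreducibility, suitable finite convex combinations of
  isometries average this form to \<open>|z|\<^sup>2\<close>, which gives the inequality without Haar measure.

  In the equality case no minimizer is used. Positive definiteness of the kernel (a mixture of
  Gaussians, each a convolution square) shows that averaging a measure over isometries does not
  increase its energy. If all Jensen gaps between the orbits of three distinct points vanished, then
  all differences would be eigenvectors for one and the same eigenvalue, whence all \<open>q\<^sub>i\<close> equal 1. A
  compactness argument makes the gap uniform over all measures of almost minimal energy.
\<close>

text \<open>Only two quadratic forms have to be averaged, those with eigenvalues \<open>q i\<close>
  and with their squares, so finitely many isometries are enough. The Schatten normalization says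
  that the \<open>q i\<close> have mean 1.

  The obstacle to strictness is uniformity. The energy is used only as an infimum, so a positive gap
  has to survive along measures approaching it, without weak limits. The gap at a single difference
  x - y can vanish, and the eigenvalue responsible may depend on the pair. A third point removes
  this freedom: nonzero eigenvectors u, v whose sum is a nonzero eigenvector share their eigenvalue.
  Letting isometries A, B act separately on x and y links all pairs A x, B y. The case A = B then
  places the points A (x - y) in one eigenspace, where the two averages give the \<open>q i\<close>
  mean 1 and mean square 1, hence variance 0. Separate actions on x and y amount to averaging the
  measure itself, which is why the energy of that average must be controlled. Where orbits nearly
  meet, the gap admits no bound by compactness; there the averaged kernel is large instead, and its
  integral is bounded by the energy.\<close>

unbundle no fps_syntax

section \<open>Eigenbases of symmetric maps and singular values\<close>

text \<open>A maximizer of the quadratic form of \<open>T\<close> on the unit sphere of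
  \<open>L\<close> is an eigenvector, since the first variation in the direction
  \<open>T v - c *\<^sub>R v\<close> must vanish. That direction lies in \<open>L\<close> by
  invariance.\<close>

lemma rayleigh_eigenvector:
  fixes T :: "'a::euclidean_space \<Rightarrow> 'a"
  assumes lin: "linear T" and sym: "\<And>x y. x \<bullet> T y = T x \<bullet> y"
    and L: "subspace L" "L \<noteq> {0}" "T ` L \<subseteq> L"
  obtains v c where "v \<in> L" "norm v = 1" "T v = c *\<^sub>R v"
proof -
  have cont: "continuous_on S T" for S
    using lin linear_continuous_on linear_conv_bounded_linear by blast
  obtain w where w: "w \<in> L" "w \<noteq> 0" using L subspace_0 by blast
  have "w /\<^sub>R norm w \<in> L \<inter> sphere 0 1" using w L by (simp add: subspace_scale)
  moreover have "compact (L \<inter> sphere 0 1)"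
    using closed_Int_compact[OF closed_subspace[OF L(1)]] by simp
  moreover have "continuous_on (L \<inter> sphere 0 1) (\<lambda>x. x \<bullet> T x)"
    by (intro continuous_intros cont)
  ultimately obtain v where v: "v \<in> L \<inter> sphere 0 1"
    and max: "\<And>x. x \<in> L \<inter> sphere 0 1 \<Longrightarrow> x \<bullet> T x \<le> v \<bullet> T v"
    using continuous_attains_sup[of "L \<inter> sphere 0 1" "\<lambda>x. x \<bullet> T x"] by blast
  define c where "c = v \<bullet> T v"
  have vv: "v \<bullet> v = 1" using v by (simp add: dot_square_norm)
  have le: "x \<bullet> T x \<le> c * (x \<bullet> x)" if "x \<in> L" for x
  proof (cases "x = 0")
    case False
    have "(x /\<^sub>R norm x) \<bullet> T (x /\<^sub>R norm x) \<le> c"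
      unfolding c_def using that False L by (intro max) (simp add: subspace_scale)
    then have "(x \<bullet> T x) / (norm x)^2 \<le> c"
      by (simp add: linear_scale[OF lin] power2_eq_square field_simps)
    then show ?thesis using False by (simp add: field_simps dot_square_norm)
  qed (simp add: linear_0[OF lin])
  define u where "u = T v - c *\<^sub>R v"
  have Tv: "T v = u + c *\<^sub>R v" by (simp add: u_def)
  have uL: "u \<in> L" unfolding u_def using v L by (auto intro!: subspace_diff subspace_scale)
  define b where "b = c * (u \<bullet> u) - u \<bullet> T u"
  have quad: "2 * t * (u \<bullet> u) \<le> t\<^sup>2 * b" for t :: real
  proof -
    have "v + t *\<^sub>R u \<in> L" using uL v L by (auto intro!: subspace_add subspace_scale)
    from le[OF this] have "(v + t *\<^sub>R u) \<bullet> (T v + t *\<^sub>R T u) \<le> c * ((v + t *\<^sub>R u) \<bullet> (v + t *\<^sub>R u))"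
      by (simp add: linear_add[OF lin] linear_scale[OF lin])
    moreover have "v \<bullet> T u = u \<bullet> T v" using sym[of v u] by (simp add: inner_commute)
    moreover have "u \<bullet> T v = u \<bullet> u + c * (u \<bullet> v)"
      by (subst Tv) (simp add: inner_add_right)
    moreover have "v \<bullet> T v = c" by (simp add: c_def)
    ultimately show ?thesis
      using vv by (simp add: b_def inner_add_left inner_add_right algebra_simps power2_eq_square inner_commute)
  qed
  have "u = 0"
  proof (rule ccontr)
    assume "u \<noteq> 0"
    then have pos: "u \<bullet> u > 0" by simp
    \<comment> \<open>Small enough for the linear term of \<open>quad\<close> to beat the quadratic
      one; the added 1 keeps the denominator positive.\<close>
    define t where "t = (u \<bullet> u) / (\<bar>b\<bar> + 1)"
    have t: "t > 0" "t * (\<bar>b\<bar> + 1) = u \<bullet> u" using pos by (auto simp: t_def field_simps)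
    have "t\<^sup>2 * b \<le> t * (t * (\<bar>b\<bar> + 1))"
      unfolding power2_eq_square mult.assoc using t(1) by (intro mult_left_mono) auto
    also have "\<dots> < 2 * t * (u \<bullet> u)" using t pos by simp
    finally show False using quad[of t] by simp
  qed
  then show ?thesis using that[of v c] v by (auto simp: u_def)
qed

text \<open>Take an orthonormal set of eigenvectors of greatest size. By symmetry of
  \<open>T\<close> its orthogonal complement is invariant, so a nonzero complement would contribute
  one more eigenvector.\<close>

lemma orthonormal_eigenbasis:
  fixes T :: "real ^ 'n \<Rightarrow> real ^ 'n"
  assumes lin: "linear T" and sym: "\<And>x y. x \<bullet> T y = T x \<bullet> y"
  obtains e :: "'n \<Rightarrow> real ^ 'n" and d :: "'n \<Rightarrow> real"
  where "\<And>i j. e i \<bullet> e j = (if i = j then 1 else 0)" "\<And>i. T (e i) = d i *\<^sub>R e i"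
proof -
  define P where "P B \<longleftrightarrow> pairwise orthogonal B \<and> (\<forall>b\<in>B. norm b = 1 \<and> (\<exists>c. T b = c *\<^sub>R b))"
    for B :: "(real ^ 'n) set"
  have ind: "independent B" if "P B" for B
    using that by (intro pairwise_orthogonal_independent) (auto simp: P_def)
  have bound: "finite B \<and> card B \<le> CARD('n)" if "P B" for B
    using independent_bound[OF ind[OF that]] by simp
  have "P {}" by (simp add: P_def)
  then obtain B where B: "P B" and max: "\<And>B'. P B' \<Longrightarrow> card B' \<le> card B"
    using ex_has_greatest_nat[of P "{}" card "CARD('n) + 1"] bound by (metis le_imp_less_Suc Suc_eq_plus1)
  define L where "L = {x. \<forall>b\<in>B. b \<bullet> x = 0}"
  have "L = {0}"
  proof (rule ccontr)
    assume "L \<noteq> {0}"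
    moreover have "subspace L" by (auto simp: L_def subspace_def inner_add_right)
    moreover have "T ` L \<subseteq> L"
      using B sym by (fastforce simp: L_def P_def)
    ultimately obtain v c where v: "v \<in> L" "norm v = 1" "T v = c *\<^sub>R v"
      using rayleigh_eigenvector[OF lin sym] by metis
    have "v \<notin> B" using v by (auto simp: L_def)
    moreover have "P (insert v B)"
      using B v by (auto simp: P_def pairwise_insert L_def orthogonal_def inner_commute)
    ultimately show False using max[of "insert v B"] bound[OF B] by simp
  qed
  have "span B = UNIV"
  proof (rule ccontr)
    assume "span B \<noteq> UNIV"
    then have "span B \<subset> span UNIV" by (simp add: psubset_eq)
    then obtain x where x: "x \<noteq> 0" "\<And>y. y \<in> span B \<Longrightarrow> orthogonal x y"
      using orthogonal_to_subspace_exists_gen[of B UNIV] by metis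
    have "x \<in> L"
      unfolding L_def using x(2) by (auto simp: orthogonal_def inner_commute intro: span_base)
    with x(1) \<open>L = {0}\<close> show False by simp
  qed
  then have "card B = CARD('n)"
    using dim_span_eq_card_independent[OF ind[OF B]] by simp
  then obtain e where e: "bij_betw e (UNIV :: 'n set) B"
    using bound[OF B] by (metis finite_class.finite_UNIV finite_same_card_bij)
  define d where "d i = (SOME c. T (e i) = c *\<^sub>R e i)" for i
  show ?thesis
  proof
    fix i j
    have "e i \<in> B" "e j \<in> B" using e by (auto simp: bij_betw_def)
    moreover have "e i \<noteq> e j" if "i \<noteq> j" using e that by (auto simp: bij_betw_def inj_def)
    ultimately show "e i \<bullet> e j = (if i = j then 1 else 0)"
      using B by (auto simp: P_def pairwise_def orthogonal_def dot_square_norm)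
    show "T (e i) = d i *\<^sub>R e i"
      unfolding d_def using B \<open>e i \<in> B\<close> by (intro someI_ex[of "\<lambda>c. T (e i) = c *\<^sub>R e i"]) (simp add: P_def)
  qed
qed

lemma orthonormal_expansion:
  fixes f :: "'n \<Rightarrow> real ^ 'n"
  assumes f: "\<And>i j. f i \<bullet> f j = (if i = j then 1 else 0)"
  shows "z = (\<Sum>i\<in>UNIV. (z \<bullet> f i) *\<^sub>R f i)" (is "_ = ?s")
proof -
  have inj: "inj f" using f by (metis injI zero_neq_one)
  have "independent (range f)"
    using f inj by (intro pairwise_orthogonal_independent)
      (auto simp: pairwise_def orthogonal_def inj_def, metis inner_zero_left zero_neq_one)
  moreover have "card (range f) = CARD('n)" using inj by (simp add: card_image)
  ultimately have "span (range f) = UNIV"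
    using card_ge_dim_independent[of "range f" UNIV] by auto
  then have zs: "z - ?s \<in> span (range f)" by simp
  have "orthogonal (z - ?s) y" if "y \<in> range f" for y
    using that by (auto simp: orthogonal_def inner_diff_left inner_sum_left f if_distrib cong: if_cong)
  then have "orthogonal (z - ?s) (z - ?s)"
    using orthogonal_to_span[OF zs] by blast
  then show ?thesis by (simp add: orthogonal_def)
qed

lemma orthonormal_parseval:
  fixes f :: "'n \<Rightarrow> real ^ 'n"
  assumes f: "\<And>i j. f i \<bullet> f j = (if i = j then 1 else 0)"
  shows "(norm z)\<^sup>2 = (\<Sum>i\<in>UNIV. (z \<bullet> f i)\<^sup>2)"
proof -
  have "(norm z)\<^sup>2 = z \<bullet> (\<Sum>i\<in>UNIV. (z \<bullet> f i) *\<^sub>R f i)"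
    using orthonormal_expansion[OF f, of z] by (metis dot_square_norm)
  then show ?thesis by (simp add: inner_sum_right power2_eq_square)
qed

lemma matrix_add_rdistrib:
  fixes A B :: "'a::semiring_1 ^ 'n ^ 'm"
  shows "(A + B) ** C = A ** C + B ** C"
  by (simp add: matrix_matrix_mult_def vec_eq_iff distrib_right sum.distrib)

lemma matrix_sub_rdistrib:
  fixes A B :: "'a::ring_1 ^ 'n ^ 'm"
  shows "(A - B) ** C = A ** C - B ** C"
  by (simp add: matrix_matrix_mult_def vec_eq_iff left_diff_distrib sum_subtractf)

text \<open>Diagonalization is carried out over the polynomial ring, with the eigenvectors as
  columns of constant polynomials, so that the factorization of the determinant records algebraic
  multiplicities.\<close>

lemma charpoly_orthogonal_diagonal:
  fixes S :: "real ^ 'n ^ 'n" and e :: "'n \<Rightarrow> real ^ 'n"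
  assumes e: "\<And>i j. e i \<bullet> e j = (if i = j then 1 else 0)"
    and d: "\<And>i. S *v e i = d i *\<^sub>R e i"
  shows "charpoly S = (\<Prod>i\<in>UNIV. [:- d i, 1:])"
proof -
  define P where "P = (\<chi> a i. [:e i $ a:] :: real poly ^ 'n ^ 'n)"
  have const_sum: "(\<Sum>k\<in>I. [:g k:]) = [:\<Sum>k\<in>I. g k:]" for g :: "'n \<Rightarrow> real" and I
    by (induction I rule: infinite_finite_induct) auto
  have "transpose P ** P = mat 1"
    using e by (simp add: vec_eq_iff P_def matrix_matrix_mult_def transpose_def mat_def const_sum
        inner_vec_def mult.commute one_pCons)
  then have "det (transpose P) * det P = 1" by (metis det_I det_mul)
  then have dP: "det P * det P = 1" by (simp add: det_transpose)
  define C where "C = (\<chi> i j. [:S $ i $ j:] :: real poly ^ 'n ^ 'n)"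
  define D where "D = (\<chi> i j. if i = j then [:- d i, 1:] else 0 :: real poly ^ 'n ^ 'n)"
  have "(mat [:0, 1:] - C) ** P = P ** D"
  proof -
    have "((mat [:0, 1:] - C) ** P) $ a $ i = (P ** D) $ a $ i" for a i
    proof -
      have "(\<Sum>k\<in>UNIV. S $ a $ k * e i $ k) = d i * e i $ a"
        using arg_cong[OF d[of i], of "\<lambda>v. v $ a"]
        by (simp add: matrix_vector_mult_def mult.commute)
      then have "(C ** P) $ a $ i = [:d i * e i $ a:]"
        by (simp add: C_def P_def matrix_matrix_mult_def const_sum mult.commute)
      moreover have "(mat [:0, 1:] ** P) $ a $ i = [:0, 1:] * [:e i $ a:]"
        by (simp add: mat_def P_def matrix_matrix_mult_def if_distrib if_distribR cong: if_cong)
      moreover have "(P ** D) $ a $ i = [:e i $ a:] * [:- d i, 1:]"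
        by (simp add: D_def P_def matrix_matrix_mult_def if_distrib if_distribR cong: if_cong)
      ultimately show ?thesis
        by (simp add: matrix_sub_rdistrib)
    qed
    then show ?thesis by (simp add: vec_eq_iff)
  qed
  then have "det (mat [:0, 1:] - C) * det P = det P * det D" by (metis det_mul)
  \<comment> \<open>Multiplying by \<open>det P\<close> once more replaces division in the
    polynomial ring, because the square of \<open>det P\<close> is 1.\<close>
  then have "(det (mat [:0, 1:] - C) * det P) * det P = (det P * det D) * det P"
    by (rule arg_cong)
  then have "det (mat [:0, 1:] - C) * (det P * det P) = (det P * det P) * det D"
    by (simp only: mult_ac)
  then have "charpoly S = det D" by (simp add: dP charpoly_def C_def)
  also have "\<dots> = (\<Prod>i\<in>UNIV. D $ i $ i)"
    by (rule det_diagonal) (simp add: D_def)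
  finally show ?thesis by (simp add: D_def)
qed

lemma singular_values_eigenbasis:
  fixes A :: "real ^ 'n ^ 'n" and e :: "'n \<Rightarrow> real ^ 'n"
  assumes e: "\<And>i j. e i \<bullet> e j = (if i = j then 1 else 0)"
    and d: "\<And>i. (transpose A ** A) *v e i = d i *\<^sub>R e i"
  shows "singular_values A = image_mset (\<lambda>i. sqrt (d i)) (mset_set UNIV)"
proof -
  have "proots (charpoly (transpose A ** A)) = (\<Sum>i\<in>UNIV. proots [:- d i, 1:])"
    by (simp add: charpoly_orthogonal_diagonal[OF e d] proots_prod)
  also have "\<dots> = image_mset d (mset_set UNIV)"
    by (simp add: proots_linear_factor sum_unfold_sum_mset)
  finally show ?thesis by (simp add: singular_values_def multiset.map_comp comp_def)
qed

text \<open>With \<open>A\<close> the inverse of \<open>M\<close> and \<open>e\<close> an eigenbasis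
  of \<open>transpose A ** A\<close>, the required frame is not \<open>e\<close> but its normalized
  images \<open>A *v e i\<close>. \<open>M\<close> sends these to \<open>e i / sqrt (d i)\<close>,
  so the coordinates of \<open>M *v z\<close> along \<open>e\<close> can be read off.\<close>

lemma inverse_singular_basis:
  fixes M :: "real ^ 'n ^ 'n"
  assumes "invertible M"
  obtains f :: "'n \<Rightarrow> real ^ 'n" and d :: "'n \<Rightarrow> real"
  where "\<And>i j. f i \<bullet> f j = (if i = j then 1 else 0)" "\<And>i. d i > 0"
    "\<And>z. (norm (M *v z))\<^sup>2 = (\<Sum>i\<in>UNIV. (z \<bullet> f i)\<^sup>2 / d i)"
    "singular_values (matrix_inv M) = image_mset (\<lambda>i. sqrt (d i)) (mset_set UNIV)"
proof -
  define A where "A = matrix_inv M"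
  have MA: "M ** A = mat 1" "A ** M = mat 1"
    using someI_ex[of "\<lambda>A'. M ** A' = mat 1 \<and> A' ** M = mat 1"] assms
    by (auto simp: A_def matrix_inv_def invertible_def)
  have TA: "x \<bullet> ((transpose A ** A) *v y) = (A *v x) \<bullet> (A *v y)" for x y
    by (metis dot_lmul_matrix inner_commute matrix_vector_mul_assoc transpose_matrix_vector)
  have "x \<bullet> ((transpose A ** A) *v y) = ((transpose A ** A) *v x) \<bullet> y" for x y
    by (metis TA inner_commute)
  then obtain e :: "'n \<Rightarrow> real ^ 'n" and d where e: "\<And>i j. e i \<bullet> e j = (if i = j then 1 else 0)"
    and d: "\<And>i. (transpose A ** A) *v e i = d i *\<^sub>R e i"
    using orthonormal_eigenbasis[OF matrix_vector_mul_linear] by metis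
  have Aee: "(A *v e i) \<bullet> (A *v e j) = (if i = j then d i else 0)" for i j
    by (simp add: d e flip: TA)
  have dpos: "d i > 0" for i
  proof -
    have "A *v e i \<noteq> 0"
    proof
      assume "A *v e i = 0"
      then have "M *v (A *v e i) = 0" by simp
      then have "e i = 0" by (simp add: matrix_vector_mul_assoc MA(1))
      then show False using e[of i i] by simp
    qed
    then show ?thesis using Aee[of i i] by (metis inner_gt_zero_iff)
  qed
  define f where "f i = (1 / sqrt (d i)) *\<^sub>R (A *v e i)" for i
  have f: "f i \<bullet> f j = (if i = j then 1 else 0)" for i j
    using dpos[of i] by (auto simp: f_def Aee)
  have Mf: "M *v f i = (1 / sqrt (d i)) *\<^sub>R e i" for i
    using MA(1) by (simp add: f_def scaleR_matrix_vector_assoc[symmetric] matrix_vector_mult_scaleR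
        matrix_vector_mul_assoc)
  have "(norm (M *v z))\<^sup>2 = (\<Sum>i\<in>UNIV. (z \<bullet> f i)\<^sup>2 / d i)" for z
  proof -
    have "M *v z = M *v (\<Sum>i\<in>UNIV. (z \<bullet> f i) *\<^sub>R f i)"
      using orthonormal_expansion[OF f, of z] by simp
    also have "\<dots> = (\<Sum>i\<in>UNIV. ((z \<bullet> f i) / sqrt (d i)) *\<^sub>R e i)"
      by (simp add: linear_sum[OF matrix_vector_mul_linear] matrix_vector_mult_scaleR Mf)
    finally have "(M *v z) \<bullet> e i = (z \<bullet> f i) / sqrt (d i)" for i
      by (simp add: inner_sum_left e if_distrib cong: if_cong)
    then show ?thesis
      using dpos by (simp add: orthonormal_parseval[OF e] power_divide less_imp_le)
  qed
  with f dpos singular_values_eigenbasis[OF e d] show ?thesis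
    using that[of f d] by (simp add: A_def)
qed

section \<open>Averaging over the isometry group\<close>

text \<open>The norm of the matrix type is the Frobenius norm. In trace form its invariance under
  orthogonal conjugation is visible, and all orthogonal matrices get the same norm.\<close>

lemma norm_matrix_trace: "(norm (X :: real ^ 'n ^ 'n))\<^sup>2 = trace (transpose X ** X)"
proof -
  have "(norm X)\<^sup>2 = (\<Sum>a\<in>UNIV. \<Sum>b\<in>UNIV. X $ a $ b * X $ a $ b)"
    by (simp add: power2_norm_eq_inner inner_vec_def)
  also have "\<dots> = (\<Sum>b\<in>UNIV. \<Sum>a\<in>UNIV. X $ a $ b * X $ a $ b)"
    by (rule sum.swap)
  finally show ?thesis by (simp add: trace_def matrix_matrix_mult_def transpose_def)
qed

lemma orthogonal_matrix_cancel:
  assumes "orthogonal_matrix U"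
  shows "transpose U ** U = mat 1" "U ** transpose U = mat 1"
    "transpose U ** (U ** X) = X" "U ** (transpose U ** X) = X"
  using assms by (simp_all add: orthogonal_matrix_def matrix_mul_assoc)

lemma norm_orthogonal_vector:
  fixes U :: "real ^ 'n ^ 'n"
  assumes "orthogonal_matrix U"
  shows "norm (U *v x) = norm x"
  using assms
  by (metis orthogonal_transformation_matrix matrix_of_matrix_vector_mul matrix_vector_mul_linear
      orthogonal_transformation)

text \<open>For the quadratic form of \<open>X\<close> this is the pullback along \<open>U\<close>,
  see \<open>inner_conj_mat\<close>. It is a right action, so composition multiplies the matrices in
  the order \<open>U ** V\<close>.\<close>

definition conj_mat :: "real ^ 'n ^ 'n \<Rightarrow> real ^ 'n ^ 'n \<Rightarrow> real ^ 'n ^ 'n" where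
  "conj_mat U X = transpose U ** X ** U"

lemma conj_mat_comp: "conj_mat V (conj_mat U X) = conj_mat (U ** V) X"
  by (simp add: conj_mat_def matrix_transpose_mul matrix_mul_assoc)

lemma linear_conj_mat: "linear (conj_mat U)"
  unfolding conj_mat_def
  by (rule linearI) (simp_all add: matrix_add_ldistrib matrix_add_rdistrib
      scalar_matrix_assoc matrix_scalar_ac)

lemma trace_conj_mat:
  assumes "orthogonal_matrix U" shows "trace (conj_mat U X) = trace X"
  by (metis assms conj_mat_def matrix_mul_assoc matrix_mul_lid orthogonal_matrix_def trace_mul_sym)

lemma norm_conj_mat:
  assumes "orthogonal_matrix U" shows "norm (conj_mat U X) = norm X"
proof -
  have "transpose (conj_mat U X) ** conj_mat U X = conj_mat U (transpose X ** X)"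
    by (simp add: conj_mat_def matrix_transpose_mul orthogonal_matrix_cancel[OF assms] flip: matrix_mul_assoc)
  then have "(norm (conj_mat U X))\<^sup>2 = (norm X)\<^sup>2"
    using trace_conj_mat[OF assms] by (simp add: norm_matrix_trace)
  then show ?thesis by simp
qed

lemma inner_conj_mat:
  fixes U X :: "real ^ 'n ^ 'n"
  shows "z \<bullet> (conj_mat U X *v z) = (U *v z) \<bullet> (X *v (U *v z))"
  by (metis conj_mat_def dot_lmul_matrix matrix_vector_mul_assoc inner_commute transpose_matrix_vector)

text \<open>The full group is used in place of the given irreducible subgroup: it is closed, hence
  compact, and irreducibility passes to it because a larger group has fewer invariant
  subspaces.\<close>

definition isometries :: "(real ^ 'n) set \<Rightarrow> (real ^ 'n ^ 'n) set" where
  "isometries K = {U. isometry_of K U}"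

lemma isometries_orthogonal: "U \<in> isometries K \<Longrightarrow> orthogonal_matrix U"
  by (simp add: isometries_def isometry_of_def)

lemma isometries_image: "U \<in> isometries K \<Longrightarrow> x \<in> K \<Longrightarrow> U *v x \<in> K"
  by (auto simp: isometries_def isometry_of_def)

lemma isometries_one: "mat 1 \<in> isometries K"
  by (simp add: isometries_def isometry_of_def orthogonal_matrix_id)

lemma isometries_mult: "U \<in> isometries K \<Longrightarrow> V \<in> isometries K \<Longrightarrow> U ** V \<in> isometries K"
  by (auto simp: isometries_def isometry_of_def orthogonal_matrix_mul simp flip: matrix_vector_mul_assoc image_image)

lemma isometries_transpose:
  assumes "U \<in> isometries K" shows "transpose U \<in> isometries K"
proof -
  have U: "orthogonal_matrix U" "(*v) U ` K = K"
    using assms by (auto simp: isometries_def isometry_of_def)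
  have "(*v) (transpose U) ` K = (*v) (transpose U) ` ((*v) U ` K)" using U by simp
  also have "\<dots> = K"
    by (simp only: image_image matrix_vector_mul_assoc orthogonal_matrix_cancel[OF U(1)]
        matrix_vector_mul_lid image_ident)
  finally show ?thesis using U by (simp add: isometries_def isometry_of_def orthogonal_matrix_transpose)
qed

text \<open>Rewrites the image condition as conditions on \<open>U\<close> and its transpose at each
  point separately. Each of these is closed in \<open>U\<close>, which gives closedness of the
  group.\<close>

lemma isometries_alt:
  "isometries (K :: (real ^ 'n) set) = {U. transpose U ** U = mat 1} \<inter>
     (\<Inter>x\<in>K. {U. U *v x \<in> K} \<inter> {U. transpose U *v x \<in> K})" (is "_ = ?R")
proof
  show "isometries K \<subseteq> ?R"
    using isometries_orthogonal isometries_image isometries_transpose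
    by (fastforce simp: orthogonal_matrix_def)
  show "?R \<subseteq> isometries K"
  proof
    fix U assume U: "U \<in> ?R"
    then have o: "orthogonal_matrix U"
      by (auto simp: orthogonal_matrix)
    have "x \<in> (*v) U ` K" if "x \<in> K" for x
    proof
      show "x = U *v (transpose U *v x)"
        by (simp add: matrix_vector_mul_assoc orthogonal_matrix_cancel[OF o] del: transpose_matrix_vector)
      show "transpose U *v x \<in> K" using U that by auto
    qed
    then show "U \<in> isometries K"
      using U o by (auto simp: isometries_def isometry_of_def)
  qed
qed

lemma continuous_on_matrix_vector: "continuous_on S (\<lambda>U :: real ^ 'n ^ 'm. U *v x)"
  by (intro linear_continuous_on_compose[OF continuous_on_id] linearI)
     (simp_all add: matrix_vector_mult_add_rdistrib scaleR_matrix_vector_assoc)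

lemma linear_transpose: "linear (transpose :: real ^ 'n ^ 'm \<Rightarrow> real ^ 'm ^ 'n)"
  by (intro linearI) (simp_all add: transpose_def vec_eq_iff)

lemma continuous_on_transpose: "continuous_on S (transpose :: real ^ 'n ^ 'm \<Rightarrow> real ^ 'm ^ 'n)"
  using linear_continuous_on_compose[OF continuous_on_id linear_transpose] by simp

lemma continuous_on_matrix_mult [continuous_intros]:
  fixes f g :: "'a::topological_space \<Rightarrow> real ^ 'n ^ 'n"
  assumes "continuous_on S f" "continuous_on S g"
  shows "continuous_on S (\<lambda>x. f x ** g x)"
  unfolding matrix_matrix_mult_def
  by (intro continuous_on_vec_lambda continuous_intros assms)

lemma compact_isometries:
  fixes K :: "(real ^ 'n) set"
  assumes "compact K" shows "compact (isometries K)"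
proof -
  have "closed {U :: real ^ 'n ^ 'n. transpose U ** U = mat 1}"
    by (intro closed_Collect_eq continuous_intros continuous_on_transpose continuous_on_id continuous_on_const)
  moreover have "closed {U :: real ^ 'n ^ 'n. U *v x \<in> K}" for x
  proof -
    have "continuous_on UNIV (\<lambda>U :: real ^ 'n ^ 'n. U *v x)"
      by (rule continuous_on_matrix_vector)
    then show ?thesis
      using continuous_closed_vimage[OF compact_imp_closed[OF assms], of "\<lambda>U :: real ^ 'n ^ 'n. U *v x"]
      by (simp add: vimage_def continuous_on_eq_continuous_at)
  qed
  moreover have "closed {U :: real ^ 'n ^ 'n. transpose U *v x \<in> K}" for x
  proof -
    have "continuous_on UNIV (\<lambda>U :: real ^ 'n ^ 'n. transpose U *v x)"
      by (rule continuous_on_compose2[OF continuous_on_matrix_vector[of UNIV x] continuous_on_transpose]) auto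
    then show ?thesis
      using continuous_closed_vimage[OF compact_imp_closed[OF assms], of "\<lambda>U :: real ^ 'n ^ 'n. transpose U *v x"]
      by (simp add: vimage_def continuous_on_eq_continuous_at)
  qed
  ultimately have "closed (isometries K)"
    unfolding isometries_alt by (intro closed_Int closed_INT ballI)
  moreover have "norm U = norm (mat 1 :: real ^ 'n ^ 'n)" if "U \<in> isometries K" for U
  proof -
    have "transpose U ** U = mat 1"
      using isometries_orthogonal[OF that] by (rule orthogonal_matrix_cancel(1))
    then have "(norm U)\<^sup>2 = (norm (mat 1 :: real ^ 'n ^ 'n))\<^sup>2"
      by (simp add: norm_matrix_trace transpose_mat)
    then show ?thesis by simp
  qed
  then have "bounded (isometries K)" by (intro boundedI[of _ "norm (mat 1 :: real ^ 'n ^ 'n)"]) simp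
  ultimately show ?thesis by (simp add: compact_eq_bounded_closed)
qed

lemma irreducible_isometries:
  assumes "has_irreducible_isometry_group K"
    and "subspace S" "\<And>U x. U \<in> isometries K \<Longrightarrow> x \<in> S \<Longrightarrow> U *v x \<in> S"
  shows "S = {0} \<or> S = UNIV"
proof -
  obtain \<U> where "irreducible_matrix_group \<U>" "\<forall>U\<in>\<U>. isometry_of K U"
    using assms(1) by (auto simp: has_irreducible_isometry_group_def)
  then show ?thesis
    using assms(2,3) unfolding irreducible_matrix_group_def isometries_def by blast
qed

text \<open>Schur's lemma over the reals. Symmetry supplies a real eigenvalue, without which
  commuting matrices may fail to be scalar (plane rotations). The eigenspace is invariant, so it is
  everything, and the trace identifies the scalar.\<close>

lemma commuting_symmetric_scalar:
  fixes X :: "real ^ 'n ^ 'n"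
  assumes irr: "has_irreducible_isometry_group K"
    and sym: "transpose X = X" and inv: "\<And>U. U \<in> isometries K \<Longrightarrow> conj_mat U X = X"
  shows "X = (trace X / real CARD('n)) *\<^sub>R mat 1"
proof -
  have "x \<bullet> (X *v y) = (X *v x) \<bullet> y" for x y
    by (metis sym dot_lmul_matrix inner_commute transpose_matrix_vector)
  then obtain v c where v: "norm v = 1" "X *v v = c *\<^sub>R v"
    using rayleigh_eigenvector[of "(*v) X" UNIV]
    by (metis UNIV_I matrix_vector_mul_linear subset_UNIV subspace_UNIV UNIV_not_singleton)
  define S where "S = {x. X *v x = c *\<^sub>R x}"
  have "subspace S"
    by (auto simp: S_def subspace_def matrix_vector_right_distrib scaleR_add_right matrix_vector_mult_scaleR)
  moreover have "U *v x \<in> S" if "U \<in> isometries K" "x \<in> S" for U x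
  proof -
    have "X ** U = U ** X"
      using inv[OF that(1)] orthogonal_matrix_cancel[OF isometries_orthogonal[OF that(1)]]
      by (metis conj_mat_def matrix_mul_assoc)
    then show ?thesis
      using that(2) by (simp add: S_def matrix_vector_mul_assoc matrix_vector_mult_scaleR flip: matrix_vector_mul_assoc)
         (metis matrix_vector_mul_assoc matrix_vector_mult_scaleR)
  qed
  ultimately have "S = {0} \<or> S = UNIV" by (rule irreducible_isometries[OF irr])
  moreover have "v \<in> S" "v \<noteq> 0" using v by (auto simp: S_def)
  ultimately have "X *v x = (c *\<^sub>R mat 1) *v x" for x
    by (metis (mono_tags) S_def UNIV_I mem_Collect_eq singletonD matrix_vector_mul_lid scaleR_matrix_vector_assoc)
  then have X: "X = c *\<^sub>R mat 1" by (metis matrix_eq)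
  have "trace X = c * real CARD('n)" by (simp add: X trace_def mat_def)
  then show ?thesis using X by simp
qed

text \<open>
  The point of the convex hull of the orbit of the pair that is nearest to the origin is fixed by
  the group, so both of its components are scalar. Translating the convex combination by a group
  element puts the identity into \<open>F\<close>.
\<close>
lemma design_matrices:
  fixes K :: "(real ^ 'n) set" and X Y :: "real ^ 'n ^ 'n"
  assumes irr: "has_irreducible_isometry_group K" and K: "compact K"
    and sym: "transpose X = X" "transpose Y = Y"
  obtains F l where "finite F" "F \<subseteq> isometries K" "mat 1 \<in> F" "\<And>U. U \<in> F \<Longrightarrow> l U > (0::real)"
    "sum l F = 1"
    "(\<Sum>U\<in>F. l U *\<^sub>R conj_mat U X) = (trace X / real CARD('n)) *\<^sub>R mat 1"
    "(\<Sum>U\<in>F. l U *\<^sub>R conj_mat U Y) = (trace Y / real CARD('n)) *\<^sub>R mat 1"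
proof -
  define G where "G = isometries K"
  define act where "act U = (\<lambda>w. (conj_mat U (fst w), conj_mat U (snd w)))" for U :: "real ^ 'n ^ 'n"
  define h where "h U = act U (X, Y)" for U
  have act_h: "act V (h U) = h (U ** V)" for U V
    by (simp add: h_def act_def conj_mat_comp)
  have lin: "linear (act U)" for U
    unfolding act_def using linear_conj_mat[of U]
    by (intro linearI) (simp_all add: linear_add linear_scale)
  have act_norm: "norm (act U w) = norm w" if "U \<in> G" for U w
    using that by (simp add: act_def norm_prod_def G_def norm_conj_mat[OF isometries_orthogonal])
  define C where "C = convex hull (h ` G)"
  have "continuous_on G h"
    unfolding h_def act_def conj_mat_def
    by (intro continuous_intros continuous_on_transpose) 
  then have "compact C"
    unfolding C_def G_def
    by (intro compact_convex_hull compact_continuous_image compact_isometries K)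
  then have C: "closed C" "convex C" "C \<noteq> {}"
    using isometries_one[of K] by (auto simp: C_def G_def compact_imp_closed)
  define v where "v = closest_point C 0"
  have v: "v \<in> C" "\<forall>w\<in>C. norm v \<le> norm w"
    using closest_point_exists[OF C(1,3), of 0] by (auto simp: v_def)
  have act_v: "act V v = v" if V: "V \<in> G" for V
  proof -
    have "act V ` C = convex hull (act V ` h ` G)"
      unfolding C_def by (rule convex_hull_linear_image[OF lin])
    also have "act V ` h ` G \<subseteq> h ` G"
      using V isometries_mult[of _ K V] by (auto simp: act_h G_def)
    then have "convex hull (act V ` h ` G) \<subseteq> C" unfolding C_def by (rule hull_mono)
    finally have "act V v \<in> C" using v by auto
    \<comment> \<open>\<open>act V v\<close> lies in \<open>C\<close> and has the same norm as
      \<open>v\<close>, so it is also nearest to the origin; nearest points of a closed convex set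
      are unique.\<close>
    then show ?thesis
      unfolding v_def
      by (intro closest_point_unique C) (use v act_norm[OF V] in \<open>auto simp: v_def\<close>)
  qed
  obtain S u where S: "finite S" "S \<subseteq> h ` G" "\<And>s. s \<in> S \<Longrightarrow> 0 \<le> u s" "sum u S = 1"
    "(\<Sum>s\<in>S. u s *\<^sub>R s) = v"
    using v(1) unfolding C_def convex_hull_explicit by blast
  \<comment> \<open>Vanishing weights are discarded because the identity must later carry a strictly
    positive weight.\<close>
  define S' where "S' = {s \<in> S. u s \<noteq> 0}"
  have S': "finite S'" "S' \<subseteq> h ` G" "\<And>s. s \<in> S' \<Longrightarrow> 0 < u s" "sum u S' = 1"
    "(\<Sum>s\<in>S'. u s *\<^sub>R s) = v"
  proof -
    show "sum u S' = 1"
      unfolding S(4)[symmetric] S'_def by (intro sum.mono_neutral_left S) auto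
    show "(\<Sum>s\<in>S'. u s *\<^sub>R s) = v"
      unfolding S(5)[symmetric] S'_def by (intro sum.mono_neutral_left S) auto
    show "\<And>s. s \<in> S' \<Longrightarrow> 0 < u s" using S(3) by (force simp: S'_def)
  qed (use S in \<open>auto simp: S'_def\<close>)
  define g where "g = inv_into G h"
  have g: "g s \<in> G" "h (g s) = s" if "s \<in> S'" for s
    using that S'(2) by (auto simp: g_def inv_into_into f_inv_into_f subset_eq)
  have "S' \<noteq> {}" using S'(4) by auto
  then obtain s0 where s0: "s0 \<in> S'" by auto
  define U0 where "U0 = g s0"
  have U0: "U0 \<in> G" "transpose U0 \<in> G" "orthogonal_matrix U0"
    using g[OF s0] isometries_transpose[of U0] isometries_orthogonal[of U0] by (auto simp: U0_def G_def)
  \<comment> \<open>Right translation by \<open>transpose U0\<close> turns the chosen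
    \<open>U0\<close> into the identity. It applies \<open>act (transpose U0)\<close> to the convex
    combination, which leaves \<open>v\<close> unchanged.\<close>
  define k where "k s = g s ** transpose U0" for s
  have k: "h (k s) = act (transpose U0) s" if "s \<in> S'" for s
    using g[OF that] by (simp add: k_def flip: act_h)
  have kU0: "k s ** U0 = g s" for s
    by (simp add: k_def orthogonal_matrix_cancel[OF U0(3)] flip: matrix_mul_assoc)
  have inj: "inj_on k S'"
    by (metis g(2) inj_onI kU0)
  define F where "F = k ` S'"
  define l where "l U = u (h (U ** U0))" for U
  have lk: "l (k s) = u s" if "s \<in> S'" for s
    using g[OF that] by (simp add: l_def kU0)
  have sumF: "(\<Sum>U\<in>F. l U *\<^sub>R h U) = v"
  proof -
    have "(\<Sum>U\<in>F. l U *\<^sub>R h U) = (\<Sum>s\<in>S'. u s *\<^sub>R act (transpose U0) s)"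
      unfolding F_def by (simp add: sum.reindex[OF inj] lk k)
    also have "\<dots> = act (transpose U0) v"
      unfolding S'(5)[symmetric] by (simp add: linear_sum[OF lin] linear_scale[OF lin])
    finally show ?thesis using act_v[OF U0(2)] by simp
  qed
  have F1: "sum l F = 1" unfolding F_def using S'(4) by (simp add: sum.reindex[OF inj] lk)
  have FG: "F \<subseteq> isometries K"
    using g U0 by (auto simp: F_def k_def G_def intro: isometries_mult)
  have "(\<Sum>U\<in>F. l U *\<^sub>R conj_mat U Z) = (trace Z / real CARD('n)) *\<^sub>R mat 1"
    if Z: "transpose Z = Z" and inv: "\<And>V. V \<in> G \<Longrightarrow> conj_mat V (\<Sum>U\<in>F. l U *\<^sub>R conj_mat U Z) = (\<Sum>U\<in>F. l U *\<^sub>R conj_mat U Z)"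
    for Z
  proof -
    define R where "R = (\<Sum>U\<in>F. l U *\<^sub>R conj_mat U Z)"
    have "transpose (conj_mat U Z) = conj_mat U Z" for U
      by (simp add: conj_mat_def matrix_transpose_mul Z matrix_mul_assoc)
    then have "transpose R = R"
      by (simp add: R_def linear_sum[OF linear_transpose] linear_scale[OF linear_transpose])
    then have R: "R = (trace R / real CARD('n)) *\<^sub>R mat 1"
      using inv by (intro commuting_symmetric_scalar[OF irr]) (auto simp: R_def G_def)
    have "trace R = (\<Sum>U\<in>F. l U * trace (conj_mat U Z))"
      by (simp add: R_def trace_def sum_component sum_distrib_left sum.swap[of _ UNIV F])
    moreover have "trace (conj_mat U Z) = trace Z" if "U \<in> F" for U
      using FG that by (intro trace_conj_mat isometries_orthogonal) auto
    ultimately have "trace R = trace Z"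
      using F1 by (simp flip: sum_distrib_right)
    with R show ?thesis by (simp add: R_def)
  qed
  note scalar = this
  have fst_snd: "(\<Sum>U\<in>F. l U *\<^sub>R conj_mat U X) = fst v" "(\<Sum>U\<in>F. l U *\<^sub>R conj_mat U Y) = snd v"
    by (simp_all add: h_def act_def fst_sum snd_sum flip: sumF)
  have inv: "conj_mat V (fst v) = fst v" "conj_mat V (snd v) = snd v" if "V \<in> G" for V
    using act_v[OF that] by (simp_all add: act_def prod_eq_iff)
  show ?thesis
  proof (rule that[of F l])
    show "finite F" using S'(1) by (simp add: F_def)
    have "k s0 = mat 1" by (simp add: k_def U0_def[symmetric] orthogonal_matrix_cancel[OF U0(3)])
    then show "mat 1 \<in> F" unfolding F_def using imageI[OF s0, of k] by simp
    show "l U > 0" if "U \<in> F" for U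
      using that S'(3) lk by (auto simp: F_def)
    show "(\<Sum>U\<in>F. l U *\<^sub>R conj_mat U X) = (trace X / real CARD('n)) *\<^sub>R mat 1"
      by (rule scalar[OF sym(1)]) (simp only: fst_snd inv)
    show "(\<Sum>U\<in>F. l U *\<^sub>R conj_mat U Y) = (trace Y / real CARD('n)) *\<^sub>R mat 1"
      by (rule scalar[OF sym(2)]) (simp only: fst_snd inv)
  qed (fact F1 FG)+
qed

text \<open>One \<open>F\<close> must serve both forms simultaneously: \<open>q\<close> for the
  inequality, and \<open>r\<close>, later the squares of \<open>q\<close>, for the equality
  case.\<close>

lemma design_quadratic_forms:
  fixes K :: "(real ^ 'n) set" and f :: "'n \<Rightarrow> real ^ 'n" and q r :: "'n \<Rightarrow> real"
  assumes "has_irreducible_isometry_group K" "compact K"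
    and f: "\<And>i j. f i \<bullet> f j = (if i = j then 1 else 0)"
  obtains F l where "finite F" "F \<subseteq> isometries K" "mat 1 \<in> F" "\<And>U. U \<in> F \<Longrightarrow> l U > (0::real)"
    "sum l F = 1"
    "\<And>z. (\<Sum>U\<in>F. l U * (\<Sum>i\<in>UNIV. q i * ((U *v z) \<bullet> f i)\<^sup>2)) = sum q UNIV / real CARD('n) * (norm z)\<^sup>2"
    "\<And>z. (\<Sum>U\<in>F. l U * (\<Sum>i\<in>UNIV. r i * ((U *v z) \<bullet> f i)\<^sup>2)) = sum r UNIV / real CARD('n) * (norm z)\<^sup>2"
proof -
  \<comment> \<open>The symmetric matrix with eigenvectors \<open>f i\<close> and eigenvalues
    \<open>g i\<close>; its trace, hence its average, depends only on the sum of
    \<open>g\<close>.\<close>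
  define Q where "Q g = (\<chi> a b. \<Sum>i\<in>UNIV. g i * f i $ a * f i $ b)" for g :: "'n \<Rightarrow> real"
  have Qsym: "transpose (Q g) = Q g" for g
    by (simp add: Q_def transpose_def vec_eq_iff mult_ac)
  have Qform: "z \<bullet> (Q g *v z) = (\<Sum>i\<in>UNIV. g i * (z \<bullet> f i)\<^sup>2)" for g z
  proof -
    have "z \<bullet> (Q g *v z) = (\<Sum>a\<in>UNIV. \<Sum>b\<in>UNIV. \<Sum>i\<in>UNIV. g i * (f i $ a * z $ a) * (f i $ b * z $ b))"
      by (simp add: Q_def inner_vec_def matrix_vector_mult_def sum_distrib_left sum_distrib_right mult_ac)
    also have "\<dots> = (\<Sum>a\<in>UNIV. \<Sum>i\<in>UNIV. \<Sum>b\<in>UNIV. g i * (f i $ a * z $ a) * (f i $ b * z $ b))"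
      by (intro sum.cong refl sum.swap)
    also have "\<dots> = (\<Sum>i\<in>UNIV. \<Sum>a\<in>UNIV. \<Sum>b\<in>UNIV. g i * (f i $ a * z $ a) * (f i $ b * z $ b))"
      by (rule sum.swap)
    also have "\<dots> = (\<Sum>i\<in>UNIV. g i * (z \<bullet> f i)\<^sup>2)"
      by (simp add: inner_vec_def power2_eq_square sum_product sum_distrib_left mult_ac)
    finally show ?thesis .
  qed
  have Qtr: "trace (Q g) = sum g UNIV" for g
  proof -
    have "trace (Q g) = (\<Sum>i\<in>UNIV. \<Sum>a\<in>UNIV. g i * f i $ a * f i $ a)"
      unfolding trace_def Q_def vec_lambda_beta by (rule sum.swap)
    also have "\<dots> = (\<Sum>i\<in>UNIV. g i * (f i \<bullet> f i))"
      by (simp add: inner_vec_def sum_distrib_left mult.assoc)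
    finally show ?thesis by (simp add: f)
  qed
  obtain F l where F: "finite F" "F \<subseteq> isometries K" "mat 1 \<in> F" "\<And>U. U \<in> F \<Longrightarrow> l U > (0::real)"
    "sum l F = 1" and eq:
    "(\<Sum>U\<in>F. l U *\<^sub>R conj_mat U (Q q)) = (trace (Q q) / real CARD('n)) *\<^sub>R mat 1"
    "(\<Sum>U\<in>F. l U *\<^sub>R conj_mat U (Q r)) = (trace (Q r) / real CARD('n)) *\<^sub>R mat 1"
    by (rule design_matrices[OF assms(1,2) Qsym[of q] Qsym[of r]]) (rule that; (assumption | simp))
  have lin: "linear (\<lambda>A :: real ^ 'n ^ 'n. z \<bullet> (A *v z))" for z
  proof (rule linearI)
    show "z \<bullet> ((A + B) *v z) = z \<bullet> (A *v z) + z \<bullet> (B *v z)" for A B :: "real ^ 'n ^ 'n"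
      by (simp add: matrix_vector_mult_add_rdistrib inner_add_right)
    show "z \<bullet> ((c *\<^sub>R A) *v z) = c *\<^sub>R (z \<bullet> (A *v z))" for A :: "real ^ 'n ^ 'n" and c
      by (simp flip: scaleR_matrix_vector_assoc)
  qed
  have "(\<Sum>U\<in>F. l U * (\<Sum>i\<in>UNIV. g i * ((U *v z) \<bullet> f i)\<^sup>2)) = sum g UNIV / real CARD('n) * (norm z)\<^sup>2"
    if "(\<Sum>U\<in>F. l U *\<^sub>R conj_mat U (Q g)) = (trace (Q g) / real CARD('n)) *\<^sub>R mat 1" for g z
  proof -
    have "(\<Sum>U\<in>F. l U * (\<Sum>i\<in>UNIV. g i * ((U *v z) \<bullet> f i)\<^sup>2)) = (\<Sum>U\<in>F. l U * (z \<bullet> (conj_mat U (Q g) *v z)))"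
      by (simp add: inner_conj_mat Qform)
    also have "\<dots> = z \<bullet> ((\<Sum>U\<in>F. l U *\<^sub>R conj_mat U (Q g)) *v z)"
      by (simp add: linear_sum[OF lin] linear_scale[OF lin])
    also have "\<dots> = sum g UNIV / real CARD('n) * (norm z)\<^sup>2"
      by (simp add: that Qtr power2_norm_eq_inner flip: scaleR_matrix_vector_assoc)
    finally show ?thesis .
  qed
  note avg = this
  show ?thesis
    by (rule that[OF F avg[OF eq(1)] avg[OF eq(2)]])
qed

section \<open>Positive definiteness of the Riesz kernel\<close>

lemma nn_integral_gaussian_real:
  assumes "s > 0"
  shows "(\<integral>\<^sup>+x. ennreal (exp (- (s * x\<^sup>2))) \<partial>lborel) = ennreal (sqrt (pi / s))"
proof -
  define \<sigma> where "\<sigma> = sqrt (1 / (2 * s))"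
  have \<sigma>: "\<sigma> > 0" "\<sigma>\<^sup>2 = 1 / (2 * s)" using assms by (auto simp: \<sigma>_def)
  have "(\<integral>\<^sup>+x. ennreal (exp (- (s * x\<^sup>2))) \<partial>lborel)
      = (\<integral>\<^sup>+x. ennreal (sqrt (pi / s)) * ennreal (normal_density 0 \<sigma> x) \<partial>lborel)"
  proof (intro nn_integral_cong)
    fix x
    have "exp (- (s * x\<^sup>2)) = sqrt (pi / s) * normal_density 0 \<sigma> x"
      using assms by (simp add: normal_density_def \<sigma>(2) field_simps)
    then show "ennreal (exp (- (s * x\<^sup>2))) = ennreal (sqrt (pi / s)) * ennreal (normal_density 0 \<sigma> x)"
      using assms by (simp add: ennreal_mult normal_density_nonneg)
  qed
  also have "\<dots> = ennreal (sqrt (pi / s))"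
    using \<sigma>(1) by (simp add: nn_integral_cmult nn_integral_eq_integral normal_density_nonneg)
  finally show ?thesis .
qed

lemma nn_integral_gaussian:
  assumes "s > 0"
  shows "(\<integral>\<^sup>+c. ennreal (exp (- (s * (norm (c :: 'a::euclidean_space))\<^sup>2))) \<partial>lborel)
    = ennreal (sqrt (pi / s) ^ DIM('a))"
proof -
  have "exp (- (s * (norm c)\<^sup>2)) = (\<Prod>b\<in>Basis. exp (- (s * (c \<bullet> b)\<^sup>2)))" for c :: 'a
  proof -
    have "(norm c)\<^sup>2 = (\<Sum>b\<in>Basis. (c \<bullet> b)\<^sup>2)"
      unfolding power2_norm_eq_inner by (subst euclidean_inner) (simp add: power2_eq_square)
    then show ?thesis by (simp add: exp_sum sum_distrib_left flip: sum_negf)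
  qed
  then have "(\<integral>\<^sup>+c. ennreal (exp (- (s * (norm (c :: 'a))\<^sup>2))) \<partial>lborel)
      = (\<integral>\<^sup>+c. (\<Prod>b\<in>Basis. ennreal (exp (- (s * ((c :: 'a) \<bullet> b)\<^sup>2)))) \<partial>lborel)"
    by (simp add: prod_ennreal)
  also have "\<dots> = (\<Prod>b\<in>(Basis :: 'a set). (\<integral>\<^sup>+x. ennreal (exp (- (s * x\<^sup>2))) \<partial>lborel))"
    by (rule nn_integral_lborel_prod) auto
  finally show ?thesis
    using assms by (simp add: nn_integral_gaussian_real ennreal_power)
qed

text \<open>Expanding about the midpoint of x and y separates the centre c from the difference x -
  y. The exponent 2t on the left is the one for which the product leaves exactly t on the
  right.\<close>

lemma gaussian_convolution:
  fixes x y :: "'a::euclidean_space"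
  assumes "t > 0"
  shows "(\<integral>\<^sup>+c. ennreal (exp (- (2 * t * (norm (x - c))\<^sup>2))) * ennreal (exp (- (2 * t * (norm (y - c))\<^sup>2))) \<partial>lborel)
    = ennreal (sqrt (pi / (4 * t)) ^ DIM('a)) * ennreal (exp (- (t * (norm (x - y))\<^sup>2)))"
proof -
  define m where "m = (1 / 2) *\<^sub>R (x + y)"
  have id: "2 * (norm (x - c))\<^sup>2 + 2 * (norm (y - c))\<^sup>2 = 4 * (norm (c - m))\<^sup>2 + (norm (x - y))\<^sup>2" for c
    unfolding m_def power2_norm_eq_inner
    by (simp add: inner_add_left inner_add_right inner_diff_left inner_diff_right inner_commute field_simps)
  have "ennreal (exp (- (2 * t * (norm (x - c))\<^sup>2))) * ennreal (exp (- (2 * t * (norm (y - c))\<^sup>2)))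
    = ennreal (exp (- (t * (norm (x - y))\<^sup>2))) * ennreal (exp (- (4 * t * (norm (c - m))\<^sup>2)))" for c
  proof -
    have "- (2 * t * (norm (x - c))\<^sup>2) + - (2 * t * (norm (y - c))\<^sup>2)
      = - (t * (norm (x - y))\<^sup>2) + - (4 * t * (norm (c - m))\<^sup>2)"
      using arg_cong[OF id[of c], of "\<lambda>u. - (t * u)"] by (simp add: algebra_simps)
    then show ?thesis by (simp add: mult_exp_exp flip: ennreal_mult)
  qed
  then have "(\<integral>\<^sup>+c. ennreal (exp (- (2 * t * (norm (x - c))\<^sup>2))) * ennreal (exp (- (2 * t * (norm (y - c))\<^sup>2))) \<partial>lborel)
     = ennreal (exp (- (t * (norm (x - y))\<^sup>2))) * (\<integral>\<^sup>+c. ennreal (exp (- (4 * t * (norm (c - m))\<^sup>2))) \<partial>lborel)"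
    by (simp add: nn_integral_cmult)
  also have "(\<integral>\<^sup>+c. ennreal (exp (- (4 * t * (norm (c - m))\<^sup>2))) \<partial>lborel)
     = (\<integral>\<^sup>+c. ennreal (exp (- (4 * t * (norm c)\<^sup>2))) \<partial>distr lborel borel ((+) (- m)))"
    by (subst nn_integral_distr) simp_all
  also have "\<dots> = ennreal (sqrt (pi / (4 * t)) ^ DIM('a))"
    using nn_integral_gaussian[of "4 * t", where 'a = 'a] assms by (simp add: lborel_distr_plus)
  finally show ?thesis by (simp add: mult.commute)
qed

lemma nn_integral_swap3:
  assumes "sigma_finite_measure N" "sigma_finite_measure L"
    and [measurable]: "(\<lambda>(t, x, y). h t x y) \<in> borel_measurable (L \<Otimes>\<^sub>M N \<Otimes>\<^sub>M N)"
  shows "(\<integral>\<^sup>+y. \<integral>\<^sup>+x. \<integral>\<^sup>+t. h t x y \<partial>L \<partial>N \<partial>N) = (\<integral>\<^sup>+t. \<integral>\<^sup>+y. \<integral>\<^sup>+x. h t x y \<partial>N \<partial>N \<partial>L)"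
proof -
  interpret N: sigma_finite_measure N by fact
  interpret L: sigma_finite_measure L by fact
  interpret pair_sigma_finite L N ..
  have "(\<integral>\<^sup>+x. \<integral>\<^sup>+t. h t x y \<partial>L \<partial>N) = (\<integral>\<^sup>+t. \<integral>\<^sup>+x. h t x y \<partial>N \<partial>L)" if y: "y \<in> space N" for y
  proof (rule Fubini')
    have "(\<lambda>(t, x). (t, x, y)) \<in> L \<Otimes>\<^sub>M N \<rightarrow>\<^sub>M L \<Otimes>\<^sub>M N \<Otimes>\<^sub>M N"
      using y by simp
    from measurable_compose[OF this assms(3)]
    show "(\<lambda>(t, x). h t x y) \<in> borel_measurable (L \<Otimes>\<^sub>M N)"
      by (simp add: case_prod_beta)
  qed
  then have "(\<integral>\<^sup>+y. \<integral>\<^sup>+x. \<integral>\<^sup>+t. h t x y \<partial>L \<partial>N \<partial>N) = (\<integral>\<^sup>+y. \<integral>\<^sup>+t. \<integral>\<^sup>+x. h t x y \<partial>N \<partial>L \<partial>N)"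
    by (intro nn_integral_cong) auto
  also have "\<dots> = (\<integral>\<^sup>+t. \<integral>\<^sup>+y. \<integral>\<^sup>+x. h t x y \<partial>N \<partial>N \<partial>L)"
  proof (rule Fubini')
    have "(\<lambda>x. (fst (fst x), snd x, snd (fst x))) \<in> (L \<Otimes>\<^sub>M N) \<Otimes>\<^sub>M N \<rightarrow>\<^sub>M L \<Otimes>\<^sub>M N \<Otimes>\<^sub>M N"
      by measurable
    from measurable_compose[OF this assms(3)]
    have [measurable]: "(\<lambda>x. h (fst (fst x)) (snd x) (snd (fst x))) \<in> borel_measurable ((L \<Otimes>\<^sub>M N) \<Otimes>\<^sub>M N)"
      by (simp add: case_prod_beta)
    show "(\<lambda>(t, y). \<integral>\<^sup>+x. h t x y \<partial>N) \<in> borel_measurable (L \<Otimes>\<^sub>M N)"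
      by measurable
  qed
  finally show ?thesis .
qed

lemma two_mult_le_squares_ennreal: "2 * (a * b) \<le> a * a + b * (b :: ennreal)"
proof (cases a; cases b)
  fix r s assume "a = ennreal r" "b = ennreal s" "0 \<le> r" "0 \<le> s"
  moreover have "2 * (r * s) \<le> r * r + s * s"
    using sum_squares_bound[of r s] by (simp add: power2_eq_square)
  ultimately show ?thesis
    by (simp flip: ennreal_mult ennreal_plus ennreal_numeral)
qed (auto simp: ennreal_mult_top ennreal_top_mult)

text \<open>Up to the constant \<open>C\<close>, \<open>J u v\<close> is the L^2 inner product of
  the smoothed images \<open>a u\<close> and \<open>a v\<close>, so the bound is the pointwise
  inequality 2ab \<le> a^2 + b^2. This additive form of positive definiteness avoids subtracting
  possibly infinite energies.\<close>

lemma gaussian_mutual_energy_le: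
  fixes f g :: "'b \<Rightarrow> 'a::euclidean_space"
  assumes N: "sigma_finite_measure N" and [measurable]: "f \<in> borel_measurable N" "g \<in> borel_measurable N"
    and t: "t > 0"
  defines "J \<equiv> \<lambda>u v. \<integral>\<^sup>+y. \<integral>\<^sup>+x. ennreal (exp (- (t * (norm (u x - v y))\<^sup>2))) \<partial>N \<partial>N"
  shows "2 * J f g \<le> J f f + J g g"
proof -
  interpret sigma_finite_measure N by fact
  define C where "C = ennreal (sqrt (pi / (4 * t)) ^ DIM('a))"
  have C: "C \<noteq> 0" "C < top" using t by (auto simp: C_def)
  define a where "a u c = (\<integral>\<^sup>+x. ennreal (exp (- (2 * t * (norm (u x - c))\<^sup>2))) \<partial>N)" for u :: "'b \<Rightarrow> 'a" and c
  have CJ: "C * J u v = (\<integral>\<^sup>+c. a u c * a v c \<partial>lborel)"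
    if [measurable]: "u \<in> borel_measurable N" "v \<in> borel_measurable N" for u v
  proof -
    have "C * J u v = (\<integral>\<^sup>+y. \<integral>\<^sup>+x. C * ennreal (exp (- (t * (norm (u x - v y))\<^sup>2))) \<partial>N \<partial>N)"
      by (simp add: J_def nn_integral_cmult)
    also have "\<dots> = (\<integral>\<^sup>+y. \<integral>\<^sup>+x. \<integral>\<^sup>+c. ennreal (exp (- (2 * t * (norm (u x - c))\<^sup>2))) *
        ennreal (exp (- (2 * t * (norm (v y - c))\<^sup>2))) \<partial>lborel \<partial>N \<partial>N)"
      by (simp only: C_def gaussian_convolution[OF t])
    also have "\<dots> = (\<integral>\<^sup>+c. \<integral>\<^sup>+y. \<integral>\<^sup>+x. ennreal (exp (- (2 * t * (norm (u x - c))\<^sup>2))) *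
        ennreal (exp (- (2 * t * (norm (v y - c))\<^sup>2))) \<partial>N \<partial>N \<partial>lborel)"
      by (rule nn_integral_swap3[OF N lborel.sigma_finite_measure_axioms]) measurable
    also have "\<dots> = (\<integral>\<^sup>+c. a u c * a v c \<partial>lborel)"
      by (simp add: a_def nn_integral_multc nn_integral_cmult)
    finally show ?thesis .
  qed
  have [measurable]: "a u \<in> borel_measurable borel" if [measurable]: "u \<in> borel_measurable N" for u
    unfolding a_def by measurable
  have "C * (2 * J f g) = 2 * (C * J f g)" by (simp add: mult_ac)
  also have "\<dots> = (\<integral>\<^sup>+c. 2 * (a f c * a g c) \<partial>lborel)"
    by (simp add: nn_integral_cmult CJ)
  also have "\<dots> \<le> (\<integral>\<^sup>+c. a f c * a f c + a g c * a g c \<partial>lborel)"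
    by (intro nn_integral_mono two_mult_le_squares_ennreal)
  also have "\<dots> = C * (J f f + J g g)"
    by (simp add: nn_integral_add CJ distrib_left)
  finally show ?thesis
    using C by (simp add: ennreal_mult_le_mult_iff)
qed

text \<open>The Gamma integral rescaled by r^2: up to the factor Gamma(p/2) it represents r^(-p) as
  a mixture of Gaussians with nonnegative weights.\<close>

definition heat_integral :: "real \<Rightarrow> real \<Rightarrow> ennreal" where
  "heat_integral p r = (\<integral>\<^sup>+t. ennreal (indicator {0<..} t * t powr (p / 2 - 1)) * ennreal (exp (- (t * r\<^sup>2))) \<partial>lborel)"

lemma heat_integral_pos:
  assumes p: "p > 0" and r: "r > 0"
  shows "heat_integral p r = ennreal (Gamma (p / 2)) * ennreal (1 / r powr p)"
proof -
  define a where "a = p / 2"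
  define c where "c = r\<^sup>2"
  have c: "c > 0" using r by (simp add: c_def)
  have ca: "c powr a = r powr p"
    using r by (simp add: c_def a_def powr_powr flip: powr_numeral)
  have "ennreal (Gamma a) = (\<integral>\<^sup>+t. ennreal (indicator {0<..} t * t powr (a - 1) * exp (- t)) \<partial>lborel)"
  proof -
    have "ennreal (Gamma a) = (\<integral>\<^sup>+t. ennreal (indicator {0..} t * t powr (a - 1) / exp t) \<partial>lborel)"
      using p by (intro Gamma_conv_nn_integral_real) (simp add: a_def)
    also have "\<dots> = (\<integral>\<^sup>+t. ennreal (indicator {0<..} t * t powr (a - 1) * exp (- t)) \<partial>lborel)"
      by (intro nn_integral_cong) (auto simp: indicator_def exp_minus field_simps)
    finally show ?thesis .
  qed
  also have "\<dots> = ennreal c * (\<integral>\<^sup>+t. ennreal (indicator {0<..} (c * t) * (c * t) powr (a - 1) * exp (- (c * t))) \<partial>lborel)"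
    using c by (subst nn_integral_real_affine[where c = c and t = 0]) auto
  also have "(\<lambda>t. ennreal (indicator {0<..} (c * t) * (c * t) powr (a - 1) * exp (- (c * t))))
      = (\<lambda>t. ennreal (c powr (a - 1)) * (ennreal (indicator {0<..} t * t powr (p / 2 - 1)) * ennreal (exp (- (t * r\<^sup>2)))))"
    using c by (auto simp: fun_eq_iff indicator_def powr_mult a_def c_def zero_less_mult_iff mult_ac simp flip: ennreal_mult)
  finally have "ennreal (Gamma a) = ennreal (c * c powr (a - 1)) * heat_integral p r"
    using c by (simp add: nn_integral_cmult heat_integral_def ennreal_mult mult.assoc)
  also have "c * c powr (a - 1) = r powr p"
    using c by (simp add: powr_diff flip: ca)
  finally have G: "ennreal (Gamma a) = ennreal (r powr p) * heat_integral p r" .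
  have "ennreal (1 / r powr p) * ennreal (Gamma a) = ennreal (1 / r powr p * r powr p) * heat_integral p r"
    unfolding G by (subst ennreal_mult) (simp_all add: mult.assoc)
  moreover have "1 / r powr p * r powr p = 1" using r by simp
  ultimately show ?thesis by (simp only: a_def ennreal_1 mult_1 mult.commute)
qed

text \<open>The integral decreases in r, so at 0 it dominates Gamma(p/2) / r^p for every r > 0. This
  makes the mixture formula valid on the diagonal too, as needed for measures with atoms.\<close>

lemma heat_integral_zero:
  assumes p: "p > 0" shows "heat_integral p 0 = \<infinity>"
proof (rule ccontr)
  assume "heat_integral p 0 \<noteq> \<infinity>"
  then obtain b where b: "heat_integral p 0 = ennreal b" "b \<ge> 0"
    by (cases "heat_integral p 0") auto
  define G where "G = Gamma (p / 2)"
  have G: "G > 0" using p by (simp add: G_def Gamma_real_pos)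
  \<comment> \<open>Solves Gamma(p/2) / r^p = b + 1, one more than the supposed finite value at
    0.\<close>
  define r where "r = ((b + 1) / G) powr (- 1 / p)"
  have "r powr p = ((b + 1) / G) powr (- 1)"
    using p unfolding r_def powr_powr by simp
  then have r: "r > 0" "1 / r powr p = (b + 1) / G"
    using b G by (auto simp: r_def powr_minus_divide)
  have "heat_integral p r \<le> heat_integral p 0"
    unfolding heat_integral_def
  proof (intro nn_integral_mono)
    show "ennreal (indicator {0<..} t * t powr (p / 2 - 1)) * ennreal (exp (- (t * r\<^sup>2)))
      \<le> ennreal (indicator {0<..} t * t powr (p / 2 - 1)) * ennreal (exp (- (t * 0\<^sup>2)))" for t
      by (cases "t > 0", intro mult_left_mono ennreal_leI) simp_all
  qed
  moreover have "heat_integral p r = ennreal (b + 1)"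
    using heat_integral_pos[OF p r(1)] G b by (simp add: r(2) flip: G_def ennreal_mult)
  ultimately show False using b by simp
qed

lemma riesz_kernel_heat:
  assumes p: "p > 0"
  shows "heat_integral p (norm (x - y)) = ennreal (Gamma (p / 2)) * riesz_kernel p x y"
proof (cases "x = y")
  case True
  have "Gamma (p / 2) > 0" using p by (simp add: Gamma_real_pos)
  then show ?thesis
    using True heat_integral_zero[OF p] by (simp add: riesz_kernel_diagonal ennreal_mult_top)
next
  case False
  then show ?thesis using heat_integral_pos[OF p, of "norm (x - y)"] by (simp add: riesz_kernel_off_diagonal)
qed

lemma borel_measurable_riesz_kernel [measurable]:
  fixes f g :: "'b \<Rightarrow> 'a::euclidean_space"
  assumes [measurable]: "f \<in> borel_measurable N" "g \<in> borel_measurable N"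
  shows "(\<lambda>x. riesz_kernel p (f x) (g x)) \<in> borel_measurable N"
  unfolding riesz_kernel_def by measurable

text \<open>Integrates the Gaussian inequality over t against the nonnegative weight
  \<open>w\<close>. Using two maps on one measure allows two different isometric images of the same
  measure to be compared.\<close>

lemma riesz_mutual_energy_le:
  fixes f g :: "'b \<Rightarrow> 'a::euclidean_space"
  assumes N: "sigma_finite_measure N" and [measurable]: "f \<in> borel_measurable N" "g \<in> borel_measurable N"
    and p: "p > 0"
  defines "E \<equiv> \<lambda>u v. \<integral>\<^sup>+y. \<integral>\<^sup>+x. riesz_kernel p (u x) (v y) \<partial>N \<partial>N"
  shows "2 * E f g \<le> E f f + E g g"
proof -
  interpret sigma_finite_measure N by fact
  define G where "G = ennreal (Gamma (p / 2))"
  have "Gamma (p / 2) > 0" using p by (simp add: Gamma_real_pos)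
  then have G: "G \<noteq> 0" "G < top" by (auto simp: G_def)
  define J where "J t u v = (\<integral>\<^sup>+y. \<integral>\<^sup>+x. ennreal (exp (- (t * (norm (u x - v y))\<^sup>2))) \<partial>N \<partial>N)"
    for t and u v :: "'b \<Rightarrow> 'a"
  define w where "w t = ennreal (indicator {0<..} t * t powr (p / 2 - 1))" for t :: real
  have [measurable]: "w \<in> borel_measurable borel" unfolding w_def by measurable
  have GE: "G * E u v = (\<integral>\<^sup>+t. w t * J t u v \<partial>lborel)"
    if [measurable]: "u \<in> borel_measurable N" "v \<in> borel_measurable N" for u v
  proof -
    have "G * E u v = (\<integral>\<^sup>+y. \<integral>\<^sup>+x. G * riesz_kernel p (u x) (v y) \<partial>N \<partial>N)"
      by (simp add: E_def nn_integral_cmult)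
    also have "\<dots> = (\<integral>\<^sup>+y. \<integral>\<^sup>+x. \<integral>\<^sup>+t. w t * ennreal (exp (- (t * (norm (u x - v y))\<^sup>2))) \<partial>lborel \<partial>N \<partial>N)"
      by (simp add: G_def w_def flip: riesz_kernel_heat[OF p] heat_integral_def)
    also have "\<dots> = (\<integral>\<^sup>+t. \<integral>\<^sup>+y. \<integral>\<^sup>+x. w t * ennreal (exp (- (t * (norm (u x - v y))\<^sup>2))) \<partial>N \<partial>N \<partial>lborel)"
      by (rule nn_integral_swap3[OF N lborel.sigma_finite_measure_axioms]) measurable
    also have "\<dots> = (\<integral>\<^sup>+t. w t * J t u v \<partial>lborel)"
      by (simp add: J_def nn_integral_cmult)
    finally show ?thesis .
  qed
  have [measurable]: "(\<lambda>t. J t u v) \<in> borel_measurable borel"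
    if [measurable]: "u \<in> borel_measurable N" "v \<in> borel_measurable N" for u v
    unfolding J_def by measurable
  have "G * (2 * E f g) = 2 * (G * E f g)" by (simp add: mult_ac)
  also have "\<dots> = (\<integral>\<^sup>+t. w t * (2 * J t f g) \<partial>lborel)"
    by (simp add: mult.left_commute[of _ 2] GE nn_integral_cmult)
  also have "\<dots> \<le> (\<integral>\<^sup>+t. w t * (J t f f + J t g g) \<partial>lborel)"
  proof (intro nn_integral_mono)
    fix t :: real
    show "w t * (2 * J t f g) \<le> w t * (J t f f + J t g g)"
      using gaussian_mutual_energy_le[OF N, of f g t]
      by (cases "t > 0") (auto simp: J_def w_def intro: mult_left_mono)
  qed
  also have "\<dots> = G * (E f f + E g g)"
    by (simp add: distrib_left nn_integral_add GE)
  finally show ?thesis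
    using G by (simp add: ennreal_mult_le_mult_iff)
qed

section \<open>Distortion of the kernel by a matrix\<close>

text \<open>The tangent at 1, obtained from exp x \<ge> 1 + x and ln u \<le> u - 1. Equality forces
  equality in the logarithmic bound, which happens only at u = 1.\<close>

lemma powr_neg_tangent:
  fixes u a :: real
  assumes "u > 0" "a > 0"
  shows "1 - a * (u - 1) \<le> u powr - a" "1 - a * (u - 1) = u powr - a \<Longrightarrow> u = 1"
proof -
  have "1 + - (a * ln u) \<le> exp (- (a * ln u))" by (rule exp_ge_add_one_self)
  then have e: "1 - a * ln u \<le> u powr - a" using assms by (simp add: powr_def)
  have l: "a * ln u \<le> a * (u - 1)" using assms ln_le_minus_one by (intro mult_left_mono) auto
  show "1 - a * (u - 1) \<le> u powr - a" using e l by simp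
  assume "1 - a * (u - 1) = u powr - a"
  then have "a * ln u = a * (u - 1)" using e l by linarith
  then have "ln u = u - 1" using assms by simp
  then show "u = 1" using assms ln_eq_minus_one by blast
qed

lemma powr_neg_jensen:
  fixes w t :: "'n::finite \<Rightarrow> real"
  assumes w: "\<And>i. w i \<ge> 0" "sum w UNIV = 1" and t: "\<And>i. t i > 0" and a: "a > 0"
  defines "S \<equiv> \<Sum>i\<in>UNIV. w i * t i"
  shows "S > 0" "S powr - a \<le> (\<Sum>i\<in>UNIV. w i * t i powr - a)"
    "S powr - a = (\<Sum>i\<in>UNIV. w i * t i powr - a) \<Longrightarrow> w j \<noteq> 0 \<Longrightarrow> t j = S"
proof -
  obtain k where k: "w k \<noteq> 0" using w(2) by (metis sum.neutral zero_neq_one)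
  have "w k * t k > 0" using k w(1)[of k] t by simp
  then show S: "S > 0"
    unfolding S_def using w t by (intro sum_pos2[of _ k]) (auto intro!: mult_nonneg_nonneg simp: less_imp_le)
  \<comment> \<open>The tangent of t^(-a) at the mean \<open>S\<close>, rescaled from the tangent at
    1. Its weighted mean is its value at \<open>S\<close>, and it touches the curve only
    there.\<close>
  define g where "g i = S powr - a * (1 - a * (t i / S - 1))" for i
  have scale: "t i powr - a = S powr - a * (t i / S) powr - a" for i
    using S t[of i] by (simp flip: powr_mult)
  have g: "g i \<le> t i powr - a" "g i = t i powr - a \<Longrightarrow> t i = S" for i
  proof -
    show "g i \<le> t i powr - a"
      unfolding g_def scale using powr_neg_tangent(1)[of "t i / S" a] S t a by (intro mult_left_mono) auto
    assume "g i = t i powr - a"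
    then have "1 - a * (t i / S - 1) = (t i / S) powr - a"
      unfolding g_def scale using S by simp
    then have "t i / S = 1" using powr_neg_tangent(2)[of "t i / S" a] S t a by auto
    then show "t i = S" using S by simp
  qed
  have sum_g: "(\<Sum>i\<in>UNIV. w i * g i) = S powr - a"
  proof -
    have "(\<Sum>i\<in>UNIV. w i * g i) = S powr - a * ((1 + a) * sum w UNIV - (a / S) * (\<Sum>i\<in>UNIV. w i * t i))"
      unfolding g_def by (simp add: sum_distrib_left sum_subtractf[symmetric] algebra_simps)
    then show ?thesis using S w(2) by (simp flip: S_def)
  qed
  show "S powr - a \<le> (\<Sum>i\<in>UNIV. w i * t i powr - a)"
    unfolding sum_g[symmetric] using g(1) w(1) by (intro sum_mono mult_left_mono) auto
  assume eq: "S powr - a = (\<Sum>i\<in>UNIV. w i * t i powr - a)" and j: "w j \<noteq> 0"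
  have "w j * t j powr - a - w j * g j = 0"
  proof -
    have "(\<Sum>i\<in>UNIV. w i * t i powr - a - w i * g i) = 0"
      using eq sum_g by (simp add: sum_subtractf)
    then show ?thesis
      using g(1) w(1) by (subst (asm) sum_nonneg_eq_0_iff) (auto intro: mult_left_mono)
  qed
  then show "t j = S" using j g(2)[of j] by simp
qed

lemma continuous_on_matrix_vector_mult:
  fixes A :: "real ^ 'n ^ 'm" and g :: "'a::euclidean_space \<Rightarrow> real ^ 'n"
  assumes "continuous_on S g" shows "continuous_on S (\<lambda>x. A *v g x)"
  by (rule linear_continuous_on_compose[OF assms matrix_vector_mul_linear])

section \<open>Jensen's inequality in the singular frame and its equality case\<close>

locale singular_frame =
  fixes M :: "real ^ 'n ^ 'n" and f :: "'n \<Rightarrow> real ^ 'n" and d :: "'n \<Rightarrow> real" and p :: real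
  assumes orthonormal: "\<And>i j. f i \<bullet> f j = (if i = j then 1 else 0)"
    and d_pos: "\<And>i. d i > 0"
    and norm_M: "\<And>z. (norm (M *v z))\<^sup>2 = (\<Sum>i\<in>UNIV. (z \<bullet> f i)\<^sup>2 / d i)"
    and p_pos: "p > 0"
begin

definition q :: "'n \<Rightarrow> real" where "q i = sqrt (d i) powr p"

lemma q_pos: "q i > 0"
  using d_pos[of i] by (simp add: q_def)

text \<open>Refers to the form that is diagonal in \<open>f\<close> with eigenvalues
  \<open>q i\<close>. The zero vector satisfies it for every \<open>c\<close>, which is why nonzero
  vectors are demanded below.\<close>

definition in_eigenspace :: "real \<Rightarrow> real ^ 'n \<Rightarrow> bool" where
  "in_eigenspace c z \<longleftrightarrow> (\<forall>i. z \<bullet> f i \<noteq> 0 \<longrightarrow> q i = c)"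

lemma exists_component:
  assumes "z \<noteq> 0" obtains i where "z \<bullet> f i \<noteq> 0"
proof -
  have "\<exists>i. z \<bullet> f i \<noteq> 0"
  proof (rule ccontr)
    assume "\<nexists>i. z \<bullet> f i \<noteq> 0"
    then have "(norm z)\<^sup>2 = 0" by (simp add: orthonormal_parseval[OF orthonormal])
    then show False using assms by simp
  qed
  then show ?thesis using that by blast
qed

lemma norm_M_pos:
  assumes "z \<noteq> 0" shows "norm (M *v z) > 0"
proof -
  obtain i where "z \<bullet> f i \<noteq> 0" by (rule exists_component[OF assms])
  then have "(\<Sum>i\<in>UNIV. (z \<bullet> f i)\<^sup>2 / d i) > 0"
    using d_pos by (intro sum_pos2[of _ i]) (auto simp: less_imp_le)
  then have "(norm (M *v z))\<^sup>2 > 0" by (simp only: norm_M)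
  then show ?thesis by simp
qed

lemma distortion:
  assumes z: "z \<noteq> 0"
  shows "norm (M *v z) powr - p \<le> norm z powr (- p - 2) * (\<Sum>i\<in>UNIV. q i * (z \<bullet> f i)\<^sup>2)" (is "?L \<le> ?R")
    and "norm (M *v z) powr - p = norm z powr (- p - 2) * (\<Sum>i\<in>UNIV. q i * (z \<bullet> f i)\<^sup>2)
      \<Longrightarrow> \<exists>c. in_eigenspace c z"
proof -
  \<comment> \<open>The squared direction cosines of \<open>z\<close> sum to 1 by Parseval, and the
    square of \<open>norm (M *v z)\<close> is that of \<open>norm z\<close> times their mean of
    \<open>1 / d i\<close>. Jensen is then applied to t^(-p/2).\<close>
  define w where "w i = (z \<bullet> f i)\<^sup>2 / (norm z)\<^sup>2" for i
  define t where "t i = 1 / d i" for i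
  define a where "a = p / 2"
  define S where "S = (\<Sum>i\<in>UNIV. w i * t i)"
  have w: "w i \<ge> 0" for i by (simp add: w_def)
  have w_sum: "sum w UNIV = 1"
    using z by (simp add: w_def flip: sum_divide_distrib orthonormal_parseval[OF orthonormal])
  have t: "t i > 0" for i using d_pos[of i] by (simp add: t_def)
  have a: "a > 0" using p_pos by (simp add: a_def)
  note J = powr_neg_jensen[of w t a, OF w w_sum t a, folded S_def]
  have q: "t i powr - a = q i" for i
  proof -
    have "t i powr - a = d i powr a"
      using d_pos[of i] by (simp add: t_def powr_minus_divide powr_divide)
    also have "\<dots> = (d i powr (1 / 2)) powr p" by (simp add: powr_powr a_def)
    also have "\<dots> = q i" using d_pos[of i] by (simp add: q_def powr_half_sqrt)
    finally show ?thesis .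
  qed
  have nz: "norm z > 0" using z by simp
  have MS: "(norm (M *v z))\<^sup>2 = (norm z)\<^sup>2 * S"
    using nz by (simp add: norm_M S_def w_def t_def sum_distrib_left)
  have p2: "x powr - p = (x\<^sup>2) powr - a" if "x > 0" for x
    using that powr_powr[of x 2 "- a"] by (simp add: a_def)
  have L: "?L = norm z powr - p * S powr - a"
    using p2[OF norm_M_pos[OF z]] p2[OF nz] J(1) nz by (simp add: MS powr_mult)
  have R: "?R = norm z powr - p * (\<Sum>i\<in>UNIV. w i * t i powr - a)"
  proof -
    have "norm z powr (- p - 2) = norm z powr - p / (norm z)\<^sup>2"
      using nz by (simp add: powr_diff)
    then show ?thesis by (simp add: q w_def sum_distrib_left mult_ac)
  qed
  show "?L \<le> ?R" unfolding L R using J(2) by (intro mult_left_mono) auto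
  assume "?L = ?R"
  then have eq: "S powr - a = (\<Sum>i\<in>UNIV. w i * t i powr - a)" unfolding L R using nz by simp
  have "in_eigenspace (S powr - a) z"
    unfolding in_eigenspace_def
  proof (intro allI impI)
    fix i assume "z \<bullet> f i \<noteq> 0"
    then have "w i \<noteq> 0" using nz by (simp add: w_def)
    then show "q i = S powr - a" using J(3)[OF eq] q by metis
  qed
  then show "\<exists>c. in_eigenspace c z" ..
qed

text \<open>For different eigenvalues of \<open>u\<close> and \<open>v\<close> their supports in the
  frame are disjoint, so \<open>u + v\<close> shows components of both kinds and could not be an
  eigenvector.\<close>

lemma eigenspace_triangle:
  assumes "u \<noteq> 0" "v \<noteq> 0" "u + v \<noteq> 0"
    and "in_eigenspace a u" "in_eigenspace b v" "in_eigenspace c (u + v)"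
  shows "a = b" "b = c"
proof -
  obtain i j k where ijk: "u \<bullet> f i \<noteq> 0" "v \<bullet> f j \<noteq> 0" "(u + v) \<bullet> f k \<noteq> 0"
    using assms(1-3) exists_component by metis
  show "a = b"
  proof (rule ccontr)
    assume "a \<noteq> b"
    then have "v \<bullet> f i = 0" "u \<bullet> f j = 0"
      using assms(4,5) ijk unfolding in_eigenspace_def by metis+
    then have "q i = c" "q j = c"
      using assms(6) ijk unfolding in_eigenspace_def by (auto simp: inner_add_left)
    then show False using \<open>a \<noteq> b\<close> assms(4,5) ijk unfolding in_eigenspace_def by metis
  qed
  moreover have "u \<bullet> f k \<noteq> 0 \<or> v \<bullet> f k \<noteq> 0" using ijk(3) by (auto simp: inner_add_left)
  ultimately show "b = c"
    using assms(4-6) ijk(3) unfolding in_eigenspace_def by metis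
qed

end

text \<open>\<open>avg\<close> has right-hand side exactly \<open>(norm z)\<^sup>2\<close> because
  the \<open>q i\<close> have mean 1; \<open>avg_sq\<close> supplies the second moment for the
  equality case. \<open>one_F\<close> makes the Jensen gap of \<open>z\<close> itself visible in the
  average.\<close>

locale averaged_frame = singular_frame M f d p
  for M :: "real ^ 'n ^ 'n" and f d p +
  fixes K :: "(real ^ 'n) set" and F :: "(real ^ 'n ^ 'n) set" and l :: "real ^ 'n ^ 'n \<Rightarrow> real"
  assumes compact_K: "compact K" and finite_F: "finite F" and F_isometries: "F \<subseteq> isometries K"
    and one_F: "mat 1 \<in> F" and l_pos: "\<And>U. U \<in> F \<Longrightarrow> l U > 0" and l_sum: "sum l F = 1"
    and avg: "\<And>z. (\<Sum>U\<in>F. l U * (\<Sum>i\<in>UNIV. q i * ((U *v z) \<bullet> f i)\<^sup>2)) = (norm z)\<^sup>2"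
    and avg_sq: "\<And>z. (\<Sum>U\<in>F. l U * (\<Sum>i\<in>UNIV. (q i)\<^sup>2 * ((U *v z) \<bullet> f i)\<^sup>2))
      = (\<Sum>i\<in>UNIV. (q i)\<^sup>2) / real CARD('n) * (norm z)\<^sup>2"
    and q_sum: "sum q UNIV = real CARD('n)"
begin

lemma F_norm: "U \<in> F \<Longrightarrow> norm (U *v z) = norm z"
  using F_isometries isometries_orthogonal norm_orthogonal_vector by blast

lemma F_zero_iff: "U \<in> F \<Longrightarrow> U *v z = 0 \<longleftrightarrow> z = 0"
  by (metis F_norm norm_eq_zero)

text \<open>At the origin every power is the default \<open>0 powr - p = 0\<close>, so the gap is 0
  there although the kernel is infinite; continuity is claimed only away from it.\<close>

definition kernel_gap :: "real ^ 'n \<Rightarrow> real" where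
  "kernel_gap z = norm z powr - p - (\<Sum>U\<in>F. l U * norm (M *v (U *v z)) powr - p)"

text \<open>Substituting \<open>avg\<close> for \<open>(norm z)\<^sup>2\<close> exhibits the gap as
  a positive combination of the Jensen gaps of the vectors \<open>U *v z\<close>, so it vanishes
  only if each of them does.\<close>

lemma kernel_gap_eq:
  assumes "z \<noteq> 0"
  shows "kernel_gap z = (\<Sum>U\<in>F. l U * (norm z powr (- p - 2) * (\<Sum>i\<in>UNIV. q i * ((U *v z) \<bullet> f i)\<^sup>2)
    - norm (M *v (U *v z)) powr - p))"
proof -
  have "norm z powr - p = norm z powr (- p - 2) * (norm z)\<^sup>2"
    using assms by (simp add: powr_diff)
  then show ?thesis
    unfolding kernel_gap_def by (simp add: right_diff_distrib sum_subtractf sum_distrib_left mult_ac flip: avg)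
qed

lemma kernel_gap_term_nonneg:
  assumes "z \<noteq> 0" "U \<in> F"
  shows "0 \<le> norm z powr (- p - 2) * (\<Sum>i\<in>UNIV. q i * ((U *v z) \<bullet> f i)\<^sup>2) - norm (M *v (U *v z)) powr - p"
  using distortion(1)[of "U *v z"] assms by (simp add: F_norm F_zero_iff)

lemma kernel_gap_nonneg: "kernel_gap z \<ge> 0"
proof (cases "z = 0")
  case False
  then show ?thesis
    unfolding kernel_gap_eq[OF False] by (intro sum_nonneg mult_nonneg_nonneg kernel_gap_term_nonneg) (auto simp: l_pos less_imp_le)
qed (simp add: kernel_gap_def)

lemma kernel_gap_zero_eigenspace:
  assumes "z \<noteq> 0" "kernel_gap z = 0" shows "\<exists>c. in_eigenspace c z"
proof -
  have "l (mat 1) * (norm z powr (- p - 2) * (\<Sum>i\<in>UNIV. q i * ((mat 1 *v z) \<bullet> f i)\<^sup>2)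
    - norm (M *v (mat 1 *v z)) powr - p) = 0"
    using assms(2) unfolding kernel_gap_eq[OF assms(1)]
    by (subst (asm) sum_nonneg_eq_0_iff[OF finite_F])
       (use one_F l_pos kernel_gap_term_nonneg[OF assms(1)] in \<open>auto intro!: mult_nonneg_nonneg simp: less_imp_le\<close>)
  then show ?thesis
    using l_pos[OF one_F] distortion(2)[OF assms(1)] by simp
qed

lemma continuous_on_kernel_gap: "continuous_on (- {0}) kernel_gap"
proof -
  have "norm (M *v (U *v z)) \<noteq> 0" if "U \<in> F" "z \<noteq> 0" for U z
    using norm_M_pos[of "U *v z"] that F_zero_iff by force
  then show ?thesis
    unfolding kernel_gap_def
    by (intro continuous_intros continuous_on_matrix_vector_mult) auto
qed

text \<open>On such vectors the forms of \<open>q\<close> and of its square act as c and c^2.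
  Comparison with \<open>avg\<close> gives c = 1, then \<open>avg_sq\<close> gives mean square 1;
  with mean 1 this means that the sum of (q i - 1)^2 is zero.\<close>

lemma orbit_in_eigenspace:
  assumes "z \<noteq> 0" and z: "\<And>A. A \<in> F \<Longrightarrow> in_eigenspace c (A *v z)"
  shows "q i = 1"
proof -
  have nz: "norm z \<noteq> 0" using assms by simp
  have sum: "(\<Sum>i\<in>UNIV. ((A *v z) \<bullet> f i)\<^sup>2) = (norm z)\<^sup>2" if "A \<in> F" for A
    using that by (simp add: F_norm flip: orthonormal_parseval[OF orthonormal])
  have eig: "(\<Sum>i\<in>UNIV. g (q i) * ((A *v z) \<bullet> f i)\<^sup>2) = g c * (norm z)\<^sup>2" if "A \<in> F" for A and g :: "real \<Rightarrow> real"
  proof -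
    have "(\<Sum>i\<in>UNIV. g (q i) * ((A *v z) \<bullet> f i)\<^sup>2) = (\<Sum>i\<in>UNIV. g c * ((A *v z) \<bullet> f i)\<^sup>2)"
      using z[OF that] unfolding in_eigenspace_def by (intro sum.cong refl) (metis mult_zero_right power_zero_numeral)
    then show ?thesis by (simp add: sum[OF that] flip: sum_distrib_left)
  qed
  have avg_g: "(\<Sum>U\<in>F. l U * (\<Sum>i\<in>UNIV. g (q i) * ((U *v z) \<bullet> f i)\<^sup>2)) = g c * (norm z)\<^sup>2" for g :: "real \<Rightarrow> real"
    using l_sum by (simp add: eig flip: sum_distrib_right)
  have "c = 1" using avg_g[of "\<lambda>x. x"] avg[of z] nz by simp
  then have "(\<Sum>i\<in>UNIV. (q i)\<^sup>2) = real CARD('n)"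
    using avg_g[of "\<lambda>x. x\<^sup>2"] avg_sq[of z] nz by (simp add: field_simps)
  then have "(\<Sum>i\<in>UNIV. (q i - 1)\<^sup>2) = 0"
    using q_sum by (simp add: power2_diff sum.distrib sum_subtractf flip: sum_distrib_left)
  then show ?thesis by (subst (asm) sum_nonneg_eq_0_iff) auto
qed

text \<open>Each choice of \<open>A\<close>, \<open>B\<close>, \<open>C\<close> gives a triangle
  \<open>A *v x\<close>, \<open>B *v y\<close>, \<open>C *v z\<close> whose sides share an
  eigenvalue. Varying one vertex at a time shows that the eigenvalue does not depend on the
  choice.\<close>

lemma degenerate_triple:
  assumes ne: "\<And>A B. A \<in> F \<Longrightarrow> B \<in> F \<Longrightarrow> A *v x \<noteq> B *v y"
      "\<And>A B. A \<in> F \<Longrightarrow> B \<in> F \<Longrightarrow> A *v y \<noteq> B *v z"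
      "\<And>A B. A \<in> F \<Longrightarrow> B \<in> F \<Longrightarrow> A *v x \<noteq> B *v z"
    and zero: "\<And>A B. A \<in> F \<Longrightarrow> B \<in> F \<Longrightarrow> kernel_gap (A *v x - B *v y) = 0"
      "\<And>A B. A \<in> F \<Longrightarrow> B \<in> F \<Longrightarrow> kernel_gap (A *v y - B *v z) = 0"
      "\<And>A B. A \<in> F \<Longrightarrow> B \<in> F \<Longrightarrow> kernel_gap (A *v x - B *v z) = 0"
  shows "q i = 1"
proof -
  have "\<exists>c. in_eigenspace c (A *v x - B *v y)" "\<exists>c. in_eigenspace c (A *v y - B *v z)"
    "\<exists>c. in_eigenspace c (A *v x - B *v z)" if "A \<in> F" "B \<in> F" for A B
    using that ne zero by (auto intro!: kernel_gap_zero_eigenspace)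
  then obtain c1 c2 c3 where c: "in_eigenspace (c1 A B) (A *v x - B *v y)"
    "in_eigenspace (c2 A B) (A *v y - B *v z)"
    "in_eigenspace (c3 A B) (A *v x - B *v z)" if "A \<in> F" "B \<in> F" for A B
    by metis
  have tri: "c1 A B = c2 B C" "c2 B C = c3 A C" if "A \<in> F" "B \<in> F" "C \<in> F" for A B C
  proof -
    have nz: "A *v x - B *v y \<noteq> 0" "B *v y - C *v z \<noteq> 0" "(A *v x - B *v y) + (B *v y - C *v z) \<noteq> 0"
      using ne that by auto
    have "in_eigenspace (c3 A C) ((A *v x - B *v y) + (B *v y - C *v z))"
      using c(3)[OF that(1,3)] by simp
    then show "c1 A B = c2 B C" "c2 B C = c3 A C"
      using eigenspace_triangle[OF nz c(1)[OF that(1,2)] c(2)[OF that(2,3)]] by auto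
  qed
  \<comment> \<open>The case of equal isometries at \<open>x\<close> and \<open>y\<close>: the side
    is then \<open>A *v (x - y)\<close>, a point of the orbit of one fixed vector.\<close>
  have "in_eigenspace (c2 (mat 1) (mat 1)) (A *v (x - y))" if "A \<in> F" for A
    using c(1)[OF that that] tri[OF that that one_F] tri[OF that one_F one_F]
    by (simp add: matrix_vector_mult_diff_distrib)
  moreover have "x - y \<noteq> 0" using ne(1)[OF one_F one_F] by auto
  ultimately show ?thesis by (rule orbit_in_eigenspace[rotated])
qed

text \<open>What the gap becomes when the measure is replaced by the weighted average of its images
  under \<open>F\<close>. \<open>averaged_kernel\<close> does the same for the kernel, in
  \<open>ennreal\<close> since the two images may coincide.\<close>

definition averaged_gap :: "real ^ 'n \<Rightarrow> real ^ 'n \<Rightarrow> real" where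
  "averaged_gap x y = (\<Sum>A\<in>F. \<Sum>B\<in>F. l A * l B * kernel_gap (A *v x - B *v y))"

definition averaged_kernel :: "real ^ 'n \<Rightarrow> real ^ 'n \<Rightarrow> ennreal" where
  "averaged_kernel x y = (\<Sum>A\<in>F. \<Sum>B\<in>F. ennreal (l A * l B) * riesz_kernel p (A *v x) (B *v y))"

lemma averaged_gap_nonneg: "averaged_gap x y \<ge> 0"
  unfolding averaged_gap_def by (intro sum_nonneg mult_nonneg_nonneg kernel_gap_nonneg) (auto simp: l_pos less_imp_le)

lemma averaged_gap_zero: 
  assumes "averaged_gap x y = 0" "A \<in> F" "B \<in> F" shows "kernel_gap (A *v x - B *v y) = 0"
proof -
  have nn: "0 \<le> l A * l B * kernel_gap (A *v x - B *v y)" if "A \<in> F" "B \<in> F" for A B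
    using that by (intro mult_nonneg_nonneg kernel_gap_nonneg) (auto simp: l_pos less_imp_le)
  have "(\<Sum>B\<in>F. l A * l B * kernel_gap (A *v x - B *v y)) = 0"
    using assms(1) unfolding averaged_gap_def
    by (subst (asm) sum_nonneg_eq_0_iff[OF finite_F]) (auto intro!: sum_nonneg nn assms(2))
  then have "l A * l B * kernel_gap (A *v x - B *v y) = 0"
    using nn assms(2,3) by (subst (asm) sum_nonneg_eq_0_iff[OF finite_F]) auto
  then show ?thesis using l_pos assms(2,3) by force
qed

text \<open>
  Either two of the orbits come so close that the averaged kernel alone exceeds \<open>E\<close>, or the triple
  lies in a compact set on which the gaps are continuous and never vanish together.
\<close>
lemma triple_lower_bound:
  assumes "q i \<noteq> 1" and E: "E > 0"
  obtains c where "c > 0"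
    "\<And>x y z. x \<in> K \<Longrightarrow> y \<in> K \<Longrightarrow> z \<in> K \<Longrightarrow>
      1 \<le> (ennreal (averaged_gap x y / c) + averaged_kernel x y * ennreal (1 / E)) + (ennreal (averaged_gap y z / c) + averaged_kernel y z * ennreal (1 / E))
        + (ennreal (averaged_gap x z / c) + averaged_kernel x z * ennreal (1 / E))"
proof -
  define m where "m = Min (l ` F)"
  have m: "m > 0" "\<And>A. A \<in> F \<Longrightarrow> m \<le> l A"
  proof -
    show "m > 0"
      unfolding m_def using finite_F one_F l_pos by (subst Min_gr_iff) auto
    show "m \<le> l A" if "A \<in> F" for A
      unfolding m_def using finite_F that by simp
  qed
  \<comment> \<open>Chosen so that a single summand of the averaged kernel, of weight at least
    \<open>m * m\<close>, already reaches \<open>E\<close> once two orbit points are closer than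
    \<open>r\<close>.\<close>
  define r where "r = (m * m / E) powr (1 / p)"
  have r: "r > 0" "r powr p = m * m / E"
    using m E p_pos by (auto simp: r_def powr_powr)
  define sep where "sep x y \<longleftrightarrow> (\<forall>A\<in>F. \<forall>B\<in>F. r \<le> norm (A *v x - B *v y))" for x y :: "real ^ 'n"
  have near: "1 \<le> averaged_kernel x y * ennreal (1 / E)" if far: "\<not> sep x y" for x y
  proof -
    obtain A B where AB: "A \<in> F" "B \<in> F" "norm (A *v x - B *v y) < r"
      using far by (auto simp: sep_def not_le)
    have "ennreal (1 / r powr p) \<le> riesz_kernel p (A *v x) (B *v y)"
    proof (cases "A *v x = B *v y")
      case False
      have "norm (A *v x - B *v y) powr p \<le> r powr p"
        using AB p_pos by (intro powr_mono2) auto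
      then show ?thesis
        using False r(1) by (auto simp: riesz_kernel_off_diagonal intro!: ennreal_leI divide_left_mono)
    qed (simp add: riesz_kernel_diagonal)
    then have "ennreal (m * m) * ennreal (1 / r powr p) \<le> ennreal (l A * l B) * riesz_kernel p (A *v x) (B *v y)"
      using m AB by (intro mult_mono ennreal_leI) (auto intro!: mult_mono simp: less_imp_le l_pos)
    also have "\<dots> \<le> (\<Sum>B\<in>F. ennreal (l A * l B) * riesz_kernel p (A *v x) (B *v y))"
      using AB finite_F by (intro member_le_sum) auto
    also have "\<dots> \<le> averaged_kernel x y"
      unfolding averaged_kernel_def using AB finite_F by (intro member_le_sum[of A F "\<lambda>A. \<Sum>B\<in>F. ennreal (l A * l B) * riesz_kernel p (A *v x) (B *v y)"]) auto
    finally have "ennreal E \<le> averaged_kernel x y"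
      using m E r by (simp flip: ennreal_mult)
    then have "ennreal E * ennreal (1 / E) \<le> averaged_kernel x y * ennreal (1 / E)" by (intro mult_right_mono) auto
    then show ?thesis using E by (simp flip: ennreal_mult)
  qed
  define D where "D = (K \<times> K \<times> K) \<inter> {(x, y, z). sep x y \<and> sep y z \<and> sep x z}"
  have cl: "closed {w. sep (a w) (b w)}" if "continuous_on UNIV a" "continuous_on UNIV b"
    for a b :: "(real ^ 'n) \<times> (real ^ 'n) \<times> (real ^ 'n) \<Rightarrow> real ^ 'n"
  proof -
    have "{w. sep (a w) (b w)} = (\<Inter>A\<in>F. \<Inter>B\<in>F. {w. r \<le> norm (A *v a w - B *v b w)})"
      by (auto simp: sep_def)
    moreover have "closed {w. r \<le> norm (A *v a w - B *v b w)}" for A B :: "real ^ 'n ^ 'n"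
      by (intro closed_Collect_le continuous_intros continuous_on_matrix_vector_mult that)
    ultimately show ?thesis by (simp add: closed_INT)
  qed
  define H where "H w = averaged_gap (fst w) (fst (snd w)) + averaged_gap (fst (snd w)) (snd (snd w)) + averaged_gap (fst w) (snd (snd w))"
    for w :: "(real ^ 'n) \<times> (real ^ 'n) \<times> (real ^ 'n)"
  have D: "D = (K \<times> K \<times> K) \<inter> ({w. sep (fst w) (fst (snd w))} \<inter> {w. sep (fst (snd w)) (snd (snd w))}
    \<inter> {w. sep (fst w) (snd (snd w))})"
    by (auto simp: D_def)
  have "compact D"
    unfolding D by (intro compact_Int_closed compact_Times compact_K closed_Int cl continuous_intros)
  moreover have "continuous_on D H"
  proof -
    have cont: "continuous_on D (\<lambda>w. averaged_gap (a w) (b w))"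
      if ab: "continuous_on D a" "continuous_on D b" "\<And>w. w \<in> D \<Longrightarrow> sep (a w) (b w)"
      for a b :: "(real ^ 'n) \<times> (real ^ 'n) \<times> (real ^ 'n) \<Rightarrow> real ^ 'n"
    proof -
      have "continuous_on D (\<lambda>w. kernel_gap (A *v a w - B *v b w))" if AB: "A \<in> F" "B \<in> F" for A B
      proof (rule continuous_on_compose2[OF continuous_on_kernel_gap])
        show "continuous_on D (\<lambda>w. A *v a w - B *v b w)"
          by (intro continuous_intros continuous_on_matrix_vector_mult ab)
        show "(\<lambda>w. A *v a w - B *v b w) ` D \<subseteq> - {0}"
          using ab(3) AB r(1) by (force simp: sep_def)
      qed
      then show ?thesis unfolding averaged_gap_def by (intro continuous_intros)
    qed
    show ?thesis unfolding H_def by (intro continuous_on_add cont continuous_intros) (auto simp: D)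
  qed
  moreover have pos: "H w > 0" if "w \<in> D" for w
  proof (rule ccontr)
    obtain x y z where w: "w = (x, y, z)" by (cases w)
    have sep: "sep x y" "sep y z" "sep x z" using that by (auto simp: D_def w)
    assume "\<not> H w > 0"
    then have "averaged_gap x y = 0" "averaged_gap y z = 0" "averaged_gap x z = 0"
      using averaged_gap_nonneg[of x y] averaged_gap_nonneg[of y z] averaged_gap_nonneg[of x z] by (auto simp: H_def w)
    moreover have ne: "A *v u \<noteq> B *v v" if "sep u v" "A \<in> F" "B \<in> F" for A B u v
      using that r(1) by (force simp: sep_def)
    ultimately have "q i = 1"
      using averaged_gap_zero ne[OF sep(1)] ne[OF sep(2)] ne[OF sep(3)] by (intro degenerate_triple[of x y z]) auto
    then show False using assms(1) by simp
  qed
  \<comment> \<open>The minimum of \<open>H\<close> on \<open>D\<close>; if \<open>D\<close> is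
    empty, any positive constant serves.\<close>
  ultimately obtain c where c: "c > 0" "\<And>w. w \<in> D \<Longrightarrow> c \<le> H w"
    using continuous_attains_inf[of D H] by (metis empty_iff zero_less_one)
  show thesis
  proof (rule that[OF c(1)])
    fix x y z assume K: "x \<in> K" "y \<in> K" "z \<in> K"
    show "1 \<le> (ennreal (averaged_gap x y / c) + averaged_kernel x y * ennreal (1 / E)) + (ennreal (averaged_gap y z / c) + averaged_kernel y z * ennreal (1 / E))
        + (ennreal (averaged_gap x z / c) + averaged_kernel x z * ennreal (1 / E))" (is "1 \<le> (?h1 + ?t1) + (?h2 + ?t2) + (?h3 + ?t3)")
    proof (cases "sep x y \<and> sep y z \<and> sep x z")
      case True
      then have "c \<le> H (x, y, z)" using K by (intro c) (auto simp: D_def)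
      then have "1 \<le> averaged_gap x y / c + averaged_gap y z / c + averaged_gap x z / c"
        using c(1) by (simp add: H_def field_simps)
      then have "1 \<le> ?h1 + ?h2 + ?h3"
        using c(1) averaged_gap_nonneg by (simp flip: ennreal_plus ennreal_1)
      also have "\<dots> \<le> (?h1 + ?t1) + (?h2 + ?t2) + (?h3 + ?t3)"
        by (intro add_mono) auto
      finally show ?thesis .
    next
      case False
      then consider "1 \<le> ?t1" | "1 \<le> ?t2" | "1 \<le> ?t3" using near by blast
      then show ?thesis
      proof cases
        case 1
        then show ?thesis by (meson add_increasing add_increasing2 zero_le)
      next
        case 2
        then show ?thesis by (meson add_increasing add_increasing2 zero_le)
      next
        case 3
        then show ?thesis by (meson add_increasing add_increasing2 zero_le)
      qed
    qed
  qed
qed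

end

section \<open>Comparison of energies\<close>

text \<open>The image of \<open>N\<close> under \<open>g\<close> is an admissible measure. Leaving
  the bound as an integral over \<open>N\<close> lets all comparisons take place on one probability
  space.\<close>

lemma riesz_energy_le:
  fixes g :: "'b \<Rightarrow> 'a::euclidean_space"
  assumes N: "prob_space N" and g: "g \<in> borel_measurable N" "\<And>x. x \<in> space N \<Longrightarrow> g x \<in> K"
  shows "riesz_energy p K \<le> (\<integral>\<^sup>+y. \<integral>\<^sup>+x. riesz_kernel p (g x) (g y) \<partial>N \<partial>N)"
proof -
  interpret N: prob_space N by fact
  define \<mu> where "\<mu> = distr N (restrict_space borel K) g"
  have gK [measurable]: "g \<in> N \<rightarrow>\<^sub>M restrict_space borel K"
    using g by (intro measurable_restrict_space2) auto
  interpret \<mu>: prob_space \<mu>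
    unfolding \<mu>_def by (rule N.prob_space_distr[OF gK])
  have id: "(\<lambda>x. x) \<in> borel_measurable (restrict_space borel K)"
    by (intro measurable_restrict_space1 measurable_ident_sets) simp
  then have [measurable]: "(\<lambda>x. x) \<in> borel_measurable \<mu>" by (simp add: \<mu>_def)
  have sets: "sets \<mu> = sets (restrict_space borel K)" by (simp add: \<mu>_def)
  moreover have "space \<mu> = K" using sets_eq_imp_space_eq[OF sets] by (simp add: space_restrict_space)
  ultimately have "\<mu> \<in> borel_prob_measures_on K"
    using \<mu>.emeasure_space_1 by (simp add: borel_prob_measures_on_def)
  then have "riesz_energy p K \<le> (\<integral>\<^sup>+y. \<integral>\<^sup>+x. riesz_kernel p x y \<partial>\<mu> \<partial>\<mu>)"
    unfolding riesz_energy_def by (rule INF_lower)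
  also have "\<dots> = (\<integral>\<^sup>+y. \<integral>\<^sup>+x. riesz_kernel p x (g y) \<partial>\<mu> \<partial>N)"
  proof -
    have "(\<lambda>y. \<integral>\<^sup>+x. riesz_kernel p x y \<partial>\<mu>) \<in> borel_measurable \<mu>"
      by measurable
    then show ?thesis
      by (subst (2) \<mu>_def) (simp add: nn_integral_distr[OF gK] \<mu>_def)
  qed
  also have "\<dots> = (\<integral>\<^sup>+y. \<integral>\<^sup>+x. riesz_kernel p (g x) (g y) \<partial>N \<partial>N)"
  proof (intro nn_integral_cong)
    fix y
    have "(\<lambda>x. riesz_kernel p x (g y)) \<in> borel_measurable \<mu>" by measurable
    then show "(\<integral>\<^sup>+x. riesz_kernel p x (g y) \<partial>\<mu>) = (\<integral>\<^sup>+x. riesz_kernel p (g x) (g y) \<partial>N)"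
      unfolding \<mu>_def by (rule nn_integral_distr[OF gK])
  qed
  finally show ?thesis .
qed

lemma borel_prob_measures_onD:
  fixes K :: "'a::euclidean_space set"
  assumes "\<mu> \<in> borel_prob_measures_on K"
  shows "prob_space \<mu>" "space \<mu> = K" "(\<lambda>x. x) \<in> borel_measurable \<mu>"
proof -
  have sets: "sets \<mu> = sets (restrict_space borel K)" and K: "emeasure \<mu> K = 1"
    using assms by (auto simp: borel_prob_measures_on_def)
  show sp: "space \<mu> = K" using sets_eq_imp_space_eq[OF sets] by (simp add: space_restrict_space)
  then show "prob_space \<mu>" using K by (intro prob_spaceI) simp
  have "(\<lambda>x. x) \<in> borel_measurable (restrict_space borel K)"
    by (intro measurable_restrict_space1 measurable_ident_sets) simp
  then show "(\<lambda>x. x) \<in> borel_measurable \<mu>"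
    unfolding measurable_cong_sets[OF sets refl] .
qed

text \<open>Bounded distances bound the kernel from below. Without positivity the capacity formula
  would meet \<open>0 powr _ = 0\<close> and stop being decreasing in the energy.\<close>

lemma riesz_energy_pos:
  fixes K :: "'a::euclidean_space set"
  assumes "bounded K" "p > 0"
  shows "riesz_energy p K > 0"
proof -
  obtain b where b: "\<And>x. x \<in> K \<Longrightarrow> norm x \<le> b" using assms(1) by (auto simp: bounded_iff)
  define B where "B = 2 * \<bar>b\<bar> + 1"
  have B: "B > 0" by (simp add: B_def)
  have k: "ennreal (1 / B powr p) \<le> riesz_kernel p x y" if "x \<in> K" "y \<in> K" for x y
  proof (cases "x = y")
    case False
    have "norm (x - y) \<le> B"
      using norm_triangle_ineq4[of x y] b[OF that(1)] b[OF that(2)] by (simp add: B_def)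
    then have "norm (x - y) powr p \<le> B powr p" using assms(2) by (intro powr_mono2) auto
    then show ?thesis
      using False B by (auto simp: riesz_kernel_off_diagonal intro!: ennreal_leI divide_left_mono)
  qed (simp add: riesz_kernel_diagonal)
  have "ennreal (1 / B powr p) \<le> riesz_energy p K"
    unfolding riesz_energy_def
  proof (rule INF_greatest)
    fix \<mu> assume "\<mu> \<in> borel_prob_measures_on K"
    note \<mu> = borel_prob_measures_onD[OF this]
    have "ennreal (1 / B powr p) = (\<integral>\<^sup>+y. \<integral>\<^sup>+x. ennreal (1 / B powr p) \<partial>\<mu> \<partial>\<mu>)"
      using prob_space.emeasure_space_1[OF \<mu>(1)] by simp
    also have "\<dots> \<le> (\<integral>\<^sup>+y. \<integral>\<^sup>+x. riesz_kernel p x y \<partial>\<mu> \<partial>\<mu>)"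
      using \<mu>(2) by (intro nn_integral_mono k) auto
    finally show "ennreal (1 / B powr p) \<le> (\<integral>\<^sup>+y. \<integral>\<^sup>+x. riesz_kernel p x y \<partial>\<mu> \<partial>\<mu>)" .
  qed
  moreover have "0 < ennreal (1 / B powr p)" using B by simp
  ultimately show ?thesis by (rule less_le_trans[rotated])
qed

lemma riesz_kernel_orthogonal:
  fixes U :: "real ^ 'n ^ 'n"
  assumes "orthogonal_matrix U"
  shows "riesz_kernel p (U *v x) (U *v y) = riesz_kernel p x y"
  by (simp add: riesz_kernel_def norm_orthogonal_vector[OF assms] flip: matrix_vector_mult_diff_distrib)

lemma borel_measurable_matrix_vector_mult [measurable]:
  fixes A :: "real ^ 'n ^ 'm"
  assumes "f \<in> borel_measurable N"
  shows "(\<lambda>x. A *v f x) \<in> borel_measurable N"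
  using borel_measurable_continuous_onI[OF linear_continuous_on_compose[OF continuous_on_id matrix_vector_mul_linear[of A]]]
  by (rule measurable_compose[OF assms])

lemma riesz_energy_orthogonal_le:
  fixes K :: "(real ^ 'n) set"
  assumes "orthogonal_matrix U"
  shows "riesz_energy p ((*v) U ` K) \<le> riesz_energy p K"
  unfolding riesz_energy_def[of p K]
proof (rule INF_greatest)
  fix \<mu> assume "\<mu> \<in> borel_prob_measures_on K"
  note \<mu> = borel_prob_measures_onD[OF this]
  have "riesz_energy p ((*v) U ` K) \<le> (\<integral>\<^sup>+y. \<integral>\<^sup>+x. riesz_kernel p (U *v x) (U *v y) \<partial>\<mu> \<partial>\<mu>)"
    using \<mu> by (intro riesz_energy_le borel_measurable_matrix_vector_mult) auto
  then show "riesz_energy p ((*v) U ` K) \<le> (\<integral>\<^sup>+y. \<integral>\<^sup>+x. riesz_kernel p x y \<partial>\<mu> \<partial>\<mu>)"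
    by (simp only: riesz_kernel_orthogonal[OF assms])
qed

lemma riesz_energy_orthogonal:
  fixes K :: "(real ^ 'n) set"
  assumes "orthogonal_matrix U"
  shows "riesz_energy p ((*v) U ` K) = riesz_energy p K"
proof (rule antisym)
  have "(*v) (transpose U) ` (*v) U ` K = K"
    by (simp only: image_image matrix_vector_mul_assoc orthogonal_matrix_cancel[OF assms]
        matrix_vector_mul_lid image_ident)
  then show "riesz_energy p K \<le> riesz_energy p ((*v) U ` K)"
    using riesz_energy_orthogonal_le[of "transpose U" p "(*v) U ` K"] assms
    by (simp add: orthogonal_matrix_transpose)
qed (rule riesz_energy_orthogonal_le[OF assms])

section \<open>Energies of averaged measures and the strict inequality\<close>

context averaged_frame
begin

text \<open>Off the diagonal this is the definition of the gap and holds with equality; on the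
  diagonal the right-hand side is infinite.\<close>

lemma kernel_average:
  "(\<Sum>U\<in>F. ennreal (l U) * riesz_kernel p (M *v (U *v x)) (M *v (U *v y))) + ennreal (kernel_gap (x - y))
    \<le> riesz_kernel p x y"
proof (cases "x = y")
  case True
  then show ?thesis by (simp add: riesz_kernel_diagonal)
next
  case False
  have "ennreal (l U) * riesz_kernel p (M *v (U *v x)) (M *v (U *v y))
      = ennreal (l U * norm (M *v (U *v (x - y))) powr - p)" if "U \<in> F" for U
  proof -
    have "M *v (U *v (x - y)) \<noteq> 0"
      using norm_M_pos[of "U *v (x - y)"] F_zero_iff[OF that, of "x - y"] False by auto
    then have "M *v (U *v x) \<noteq> M *v (U *v y)" by (auto simp: matrix_vector_mult_diff_distrib)
    then show ?thesis
      using l_pos[OF that]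
      by (simp add: riesz_kernel_off_diagonal matrix_vector_mult_diff_distrib powr_minus_divide flip: ennreal_mult')
  qed
  then have "(\<Sum>U\<in>F. ennreal (l U) * riesz_kernel p (M *v (U *v x)) (M *v (U *v y)))
      = ennreal (\<Sum>U\<in>F. l U * norm (M *v (U *v (x - y))) powr - p)"
    using l_pos by (simp add: sum_ennreal less_imp_le)
  moreover have "0 \<le> (\<Sum>U\<in>F. l U * norm (M *v (U *v (x - y))) powr - p)"
    using l_pos by (intro sum_nonneg mult_nonneg_nonneg) (auto simp: less_imp_le)
  ultimately have "(\<Sum>U\<in>F. ennreal (l U) * riesz_kernel p (M *v (U *v x)) (M *v (U *v y))) + ennreal (kernel_gap (x - y))
      = ennreal (norm (x - y) powr - p)"
    using kernel_gap_nonneg[of "x - y"] by (simp add: kernel_gap_def flip: ennreal_plus)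
  also have "\<dots> = riesz_kernel p x y"
    using False by (simp add: riesz_kernel_off_diagonal powr_minus_divide)
  finally show ?thesis by simp
qed

text \<open>
  The action pushes the product of this measure and \<open>\<mu>\<close> forward to the average of the images of
  \<open>\<mu>\<close> under \<open>F\<close> with weights \<open>l\<close>.
\<close>
definition mixing :: "(real ^ 'n ^ 'n) measure" where
  "mixing = point_measure F (\<lambda>U. ennreal (l U))"

lemma prob_mixing: "prob_space mixing"
proof (rule prob_spaceI)
  have "emeasure mixing F = (\<Sum>U\<in>F. ennreal (l U))"
    unfolding mixing_def using finite_F by (simp add: emeasure_point_measure_finite)
  also have "\<dots> = 1" using l_pos l_sum by (simp add: sum_ennreal less_imp_le)
  finally show "emeasure mixing (space mixing) = 1" by (simp add: mixing_def space_point_measure)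
qed

lemma measurable_action:
  assumes "\<mu> \<in> borel_prob_measures_on K"
  shows "(\<lambda>w. fst w *v snd w) \<in> borel_measurable (mixing \<Otimes>\<^sub>M \<mu>)"
proof -
  note \<mu> = borel_prob_measures_onD[OF assms]
  have "(\<lambda>w. fst w *v snd w) \<in> borel_measurable (count_space F \<Otimes>\<^sub>M \<mu>)"
    using \<mu>(3) finite_F by (intro measurable_pair_measure_countable1) (auto simp: countable_finite)
  moreover have "sets (count_space F \<Otimes>\<^sub>M \<mu>) = sets (mixing \<Otimes>\<^sub>M \<mu>)"
    by (intro sets_pair_measure_cong) (simp_all add: mixing_def sets_point_measure)
  ultimately show ?thesis using measurable_cong_sets by blast
qed

lemma nn_integral_averaged:
  assumes \<mu>: "\<mu> \<in> borel_prob_measures_on K" and "u \<in> borel_measurable (mixing \<Otimes>\<^sub>M \<mu>)"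
  shows "integral\<^sup>N (mixing \<Otimes>\<^sub>M \<mu>) u = (\<Sum>A\<in>F. ennreal (l A) * (\<integral>\<^sup>+x. u (A, x) \<partial>\<mu>))"
proof -
  interpret \<mu>: prob_space \<mu> using borel_prob_measures_onD[OF \<mu>] by simp
  have "integral\<^sup>N (mixing \<Otimes>\<^sub>M \<mu>) u = (\<integral>\<^sup>+A. \<integral>\<^sup>+x. u (A, x) \<partial>\<mu> \<partial>mixing)"
    by (rule \<mu>.nn_integral_fst[symmetric]) fact
  then show ?thesis by (simp add: mixing_def nn_integral_point_measure_finite[OF finite_F])
qed

lemma double_integral_averaged:
  assumes \<mu>: "\<mu> \<in> borel_prob_measures_on K"
    and \<phi>: "(\<lambda>w. \<phi> (fst w) (snd w)) \<in> borel_measurable (borel \<Otimes>\<^sub>M borel)"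
  shows "(\<integral>\<^sup>+w'. \<integral>\<^sup>+w. \<phi> (fst w *v snd w) (fst w' *v snd w') \<partial>(mixing \<Otimes>\<^sub>M \<mu>) \<partial>(mixing \<Otimes>\<^sub>M \<mu>))
    = (\<integral>\<^sup>+y. \<integral>\<^sup>+x. (\<Sum>A\<in>F. \<Sum>B\<in>F. ennreal (l A * l B) * \<phi> (A *v x) (B *v y)) \<partial>\<mu> \<partial>\<mu>)"
proof -
  note \<mu>' = borel_prob_measures_onD[OF \<mu>]
  note [measurable] = \<mu>'(3) measurable_action[OF \<mu>]
  interpret \<mu>: prob_space \<mu> by fact
  interpret mixing: prob_space mixing by (rule prob_mixing)
  interpret N: pair_prob_space mixing \<mu> ..
  have \<phi>_comp [measurable]: "(\<lambda>w. \<phi> (a w) (b w)) \<in> borel_measurable Q"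
    if [measurable]: "a \<in> borel_measurable Q" "b \<in> borel_measurable Q" for a b :: "'z \<Rightarrow> real ^ 'n" and Q
    using measurable_compose[OF measurable_Pair[OF that] \<phi>] by simp
  have "(\<integral>\<^sup>+w'. \<integral>\<^sup>+w. \<phi> (fst w *v snd w) (fst w' *v snd w') \<partial>(mixing \<Otimes>\<^sub>M \<mu>) \<partial>(mixing \<Otimes>\<^sub>M \<mu>))
     = (\<integral>\<^sup>+w'. (\<Sum>A\<in>F. ennreal (l A) * (\<integral>\<^sup>+x. \<phi> (A *v x) (fst w' *v snd w') \<partial>\<mu>)) \<partial>(mixing \<Otimes>\<^sub>M \<mu>))"
    by (intro nn_integral_cong) (subst nn_integral_averaged[OF \<mu>], auto)
  also have "\<dots> = (\<Sum>B\<in>F. ennreal (l B) * (\<integral>\<^sup>+y. (\<Sum>A\<in>F. ennreal (l A) * (\<integral>\<^sup>+x. \<phi> (A *v x) (B *v y) \<partial>\<mu>)) \<partial>\<mu>))"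
    by (subst nn_integral_averaged[OF \<mu>]) auto
  also have "\<dots> = (\<integral>\<^sup>+y. (\<Sum>B\<in>F. ennreal (l B) * (\<Sum>A\<in>F. ennreal (l A) * (\<integral>\<^sup>+x. \<phi> (A *v x) (B *v y) \<partial>\<mu>))) \<partial>\<mu>)"
    by (subst nn_integral_sum) (auto simp: nn_integral_cmult)
  also have "\<dots> = (\<integral>\<^sup>+y. \<integral>\<^sup>+x. (\<Sum>B\<in>F. ennreal (l B) * (\<Sum>A\<in>F. ennreal (l A) * \<phi> (A *v x) (B *v y))) \<partial>\<mu> \<partial>\<mu>)"
    by (intro nn_integral_cong) (simp add: nn_integral_sum nn_integral_cmult)
  also have "\<dots> = (\<integral>\<^sup>+y. \<integral>\<^sup>+x. (\<Sum>A\<in>F. \<Sum>B\<in>F. ennreal (l A * l B) * \<phi> (A *v x) (B *v y)) \<partial>\<mu> \<partial>\<mu>)"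
    by (subst sum.swap) (simp add: sum_distrib_left ennreal_mult l_pos less_imp_le mult_ac)
  finally show ?thesis .
qed

lemma borel_measurable_kernel_gap [measurable]: "kernel_gap \<in> borel_measurable borel"
  unfolding kernel_gap_def by measurable

text \<open>\<open>F\<close> enters twice: through \<open>N\<close>, which averages the measure, and
  through the maps \<open>M U\<close>, each of which carries that average to a test measure on the
  image of \<open>K\<close>. Averaging these test energies and integrating
  \<open>kernel_average\<close> leaves the gap as surplus.\<close>

lemma energy_gap:
  assumes \<mu>: "\<mu> \<in> borel_prob_measures_on K"
  shows "riesz_energy p ((*v) M ` K) + (\<integral>\<^sup>+y. \<integral>\<^sup>+x. ennreal (averaged_gap x y) \<partial>\<mu> \<partial>\<mu>)
      \<le> (\<integral>\<^sup>+y. \<integral>\<^sup>+x. averaged_kernel x y \<partial>\<mu> \<partial>\<mu>)"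
proof -
  note \<mu>' = borel_prob_measures_onD[OF \<mu>]
  define N where "N = mixing \<Otimes>\<^sub>M \<mu>"
  define g where "g w = fst w *v snd w" for w :: "(real ^ 'n ^ 'n) \<times> (real ^ 'n)"
  interpret \<mu>: prob_space \<mu> by fact
  interpret mixing: prob_space mixing by (rule prob_mixing)
  interpret pair: pair_prob_space mixing \<mu> ..
  interpret N: prob_space N unfolding N_def by (rule pair.P.prob_space_axioms)
  have g [measurable]: "g \<in> borel_measurable N"
    unfolding g_def N_def by (rule measurable_action[OF \<mu>])
  have gK: "g w \<in> K" if "w \<in> space N" for w
  proof -
    have "A *v x \<in> K" if "A \<in> F" "x \<in> K" for A x
      using that F_isometries by (intro isometries_image) auto
    then show ?thesis
      using that \<mu>'(2) by (auto simp: N_def g_def space_pair_measure mixing_def space_point_measure)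
  qed
  let ?k = "riesz_kernel p"
  let ?E = "riesz_energy p ((*v) M ` K)"
  have "?E = (\<Sum>U\<in>F. ennreal (l U) * ?E)"
    using l_sum l_pos by (simp add: sum_ennreal less_imp_le flip: sum_distrib_right)
  also have "\<dots> \<le> (\<Sum>U\<in>F. ennreal (l U) * (\<integral>\<^sup>+w'. \<integral>\<^sup>+w. ?k (M *v (U *v g w)) (M *v (U *v g w')) \<partial>N \<partial>N))"
  proof (intro sum_mono mult_left_mono riesz_energy_le N.prob_space_axioms)
    fix U w assume "U \<in> F" "w \<in> space N"
    then have "U *v g w \<in> K" using F_isometries by (intro isometries_image gK) auto
    then show "M *v (U *v g w) \<in> (*v) M ` K" by (rule imageI)
  qed simp_all
  also have "\<dots> = (\<integral>\<^sup>+w'. \<integral>\<^sup>+w. (\<Sum>U\<in>F. ennreal (l U) * ?k (M *v (U *v g w)) (M *v (U *v g w'))) \<partial>N \<partial>N)"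
    by (simp add: nn_integral_sum nn_integral_cmult)
  finally have "?E + (\<integral>\<^sup>+w'. \<integral>\<^sup>+w. ennreal (kernel_gap (g w - g w')) \<partial>N \<partial>N)
    \<le> (\<integral>\<^sup>+w'. \<integral>\<^sup>+w. (\<Sum>U\<in>F. ennreal (l U) * ?k (M *v (U *v g w)) (M *v (U *v g w'))) \<partial>N \<partial>N)
      + (\<integral>\<^sup>+w'. \<integral>\<^sup>+w. ennreal (kernel_gap (g w - g w')) \<partial>N \<partial>N)"
    by (rule add_right_mono)
  also have "\<dots> = (\<integral>\<^sup>+w'. \<integral>\<^sup>+w. (\<Sum>U\<in>F. ennreal (l U) * ?k (M *v (U *v g w)) (M *v (U *v g w')))
      + ennreal (kernel_gap (g w - g w')) \<partial>N \<partial>N)"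
    by (simp add: nn_integral_add)
  also have "\<dots> \<le> (\<integral>\<^sup>+w'. \<integral>\<^sup>+w. ?k (g w) (g w') \<partial>N \<partial>N)"
    by (intro nn_integral_mono kernel_average)
  also have "\<dots> = (\<integral>\<^sup>+y. \<integral>\<^sup>+x. averaged_kernel x y \<partial>\<mu> \<partial>\<mu>)"
    unfolding N_def g_def averaged_kernel_def by (rule double_integral_averaged[OF \<mu>]) measurable
  also have "(\<integral>\<^sup>+w'. \<integral>\<^sup>+w. ennreal (kernel_gap (g w - g w')) \<partial>N \<partial>N) = (\<integral>\<^sup>+y. \<integral>\<^sup>+x. ennreal (averaged_gap x y) \<partial>\<mu> \<partial>\<mu>)"
  proof -
    have "(\<integral>\<^sup>+w'. \<integral>\<^sup>+w. ennreal (kernel_gap (g w - g w')) \<partial>N \<partial>N)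
      = (\<integral>\<^sup>+y. \<integral>\<^sup>+x. (\<Sum>A\<in>F. \<Sum>B\<in>F. ennreal (l A * l B) * ennreal (kernel_gap (A *v x - B *v y))) \<partial>\<mu> \<partial>\<mu>)"
      unfolding N_def g_def by (rule double_integral_averaged[OF \<mu>]) measurable
    also have "\<dots> = (\<integral>\<^sup>+y. \<integral>\<^sup>+x. ennreal (averaged_gap x y) \<partial>\<mu> \<partial>\<mu>)"
    proof -
      have "(\<Sum>A\<in>F. \<Sum>B\<in>F. ennreal (l A * l B) * ennreal (kernel_gap (A *v x - B *v y))) = ennreal (averaged_gap x y)" for x y
      proof -
        have nn: "0 \<le> l A * l B * kernel_gap (A *v x - B *v y)" if "A \<in> F" "B \<in> F" for A B
          using that by (intro mult_nonneg_nonneg kernel_gap_nonneg) (auto simp: l_pos less_imp_le)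
        have "(\<Sum>A\<in>F. \<Sum>B\<in>F. ennreal (l A * l B) * ennreal (kernel_gap (A *v x - B *v y)))
            = (\<Sum>A\<in>F. \<Sum>B\<in>F. ennreal (l A * l B * kernel_gap (A *v x - B *v y)))"
          by (intro sum.cong refl) (simp add: ennreal_mult' kernel_gap_nonneg l_pos less_imp_le)
        also have "\<dots> = ennreal (averaged_gap x y)"
          unfolding averaged_gap_def using nn by (simp add: sum_ennreal sum_nonneg)
        finally show ?thesis .
      qed
      then show ?thesis by simp
    qed
    finally show ?thesis .
  qed
  finally show ?thesis .
qed

text \<open>Every self-energy \<open>I A A\<close> equals the energy of \<mu> because isometries
  preserve the kernel. By positive definiteness no mutual energy exceeds it, and the weights
  \<open>l A * l B\<close> sum to 1.\<close>

lemma averaged_energy_le: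
  assumes \<mu>: "\<mu> \<in> borel_prob_measures_on K"
  shows "(\<integral>\<^sup>+y. \<integral>\<^sup>+x. averaged_kernel x y \<partial>\<mu> \<partial>\<mu>) \<le> (\<integral>\<^sup>+y. \<integral>\<^sup>+x. riesz_kernel p x y \<partial>\<mu> \<partial>\<mu>)" (is "_ \<le> ?E")
proof -
  note [measurable] = borel_prob_measures_onD(3)[OF \<mu>]
  interpret \<mu>: prob_space \<mu> using borel_prob_measures_onD[OF \<mu>] by simp
  define I where "I A B = (\<integral>\<^sup>+y. \<integral>\<^sup>+x. riesz_kernel p (A *v x) (B *v y) \<partial>\<mu> \<partial>\<mu>)" for A B :: "real ^ 'n ^ 'n"
  have diag: "I A A = ?E" if "A \<in> F" for A
    using that F_isometries isometries_orthogonal unfolding I_def by (subst riesz_kernel_orthogonal) auto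
  have I: "I A B \<le> ?E" if "A \<in> F" "B \<in> F" for A B
  proof -
    have "2 * I A B \<le> I A A + I B B"
      unfolding I_def
      by (intro riesz_mutual_energy_le \<mu>.sigma_finite_measure_axioms p_pos) measurable
    then have "2 * I A B \<le> 2 * ?E" using diag that by (simp add: mult_2)
    then show ?thesis by (simp add: ennreal_mult_le_mult_iff)
  qed
  have "(\<integral>\<^sup>+y. \<integral>\<^sup>+x. averaged_kernel x y \<partial>\<mu> \<partial>\<mu>) = (\<Sum>A\<in>F. \<Sum>B\<in>F. ennreal (l A * l B) * I A B)"
    unfolding averaged_kernel_def I_def by (simp add: nn_integral_sum nn_integral_cmult)
  also have "\<dots> \<le> (\<Sum>A\<in>F. \<Sum>B\<in>F. ennreal (l A * l B) * ?E)"
    by (intro sum_mono mult_left_mono I) auto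
  also have "\<dots> = ennreal (\<Sum>A\<in>F. \<Sum>B\<in>F. l A * l B) * ?E"
    using l_pos by (simp add: sum_ennreal sum_nonneg less_imp_le flip: sum_distrib_right)
  also have "(\<Sum>A\<in>F. \<Sum>B\<in>F. l A * l B) = 1"
    using l_sum by (simp flip: sum_product)
  finally show ?thesis by simp
qed

lemma riesz_energy_image_le: "riesz_energy p ((*v) M ` K) \<le> riesz_energy p K"
  unfolding riesz_energy_def[of p K]
proof (rule INF_greatest)
  fix \<mu> assume \<mu>: "\<mu> \<in> borel_prob_measures_on K"
  have "riesz_energy p ((*v) M ` K) \<le> riesz_energy p ((*v) M ` K) + (\<integral>\<^sup>+y. \<integral>\<^sup>+x. ennreal (averaged_gap x y) \<partial>\<mu> \<partial>\<mu>)"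
    by simp
  also note energy_gap[OF \<mu>]
  also note averaged_energy_le[OF \<mu>]
  finally show "riesz_energy p ((*v) M ` K) \<le> (\<integral>\<^sup>+y. \<integral>\<^sup>+x. riesz_kernel p x y \<partial>\<mu> \<partial>\<mu>)" .
qed

lemma borel_measurable_averaged_gap [measurable]: 
  assumes [measurable]: "a \<in> borel_measurable Q" "b \<in> borel_measurable Q"
  shows "(\<lambda>w. averaged_gap (a w) (b w)) \<in> borel_measurable Q"
  unfolding averaged_gap_def by measurable

lemma borel_measurable_averaged_kernel [measurable]: 
  assumes [measurable]: "a \<in> borel_measurable Q" "b \<in> borel_measurable Q"
  shows "(\<lambda>w. averaged_kernel (a w) (b w)) \<in> borel_measurable Q"
  unfolding averaged_kernel_def by measurable

lemma riesz_energy_image_less: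
  assumes "q i \<noteq> 1" and fin: "riesz_energy p K < \<infinity>"
  shows "riesz_energy p ((*v) M ` K) < riesz_energy p K"
proof (rule ccontr)
  assume "\<not> ?thesis"
  then have eq: "riesz_energy p ((*v) M ` K) = riesz_energy p K" using riesz_energy_image_le by (simp add: not_less)
  obtain v where v: "riesz_energy p K = ennreal v" "v \<ge> 0" using fin by (cases "riesz_energy p K") auto
  \<comment> \<open>Makes the kernel contribution \<open>S / E\<close> less than 1/6 as soon as
    \<open>S\<close> is below \<open>v + 1\<close>.\<close>
  define E where "E = 6 * (v + 1)"
  have E: "E > 0" using v by (simp add: E_def)
  obtain c where c: "c > 0" and lower:
    "\<And>x y z. x \<in> K \<Longrightarrow> y \<in> K \<Longrightarrow> z \<in> K \<Longrightarrow>
      1 \<le> (ennreal (averaged_gap x y / c) + averaged_kernel x y * ennreal (1 / E)) + (ennreal (averaged_gap y z / c) + averaged_kernel y z * ennreal (1 / E))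
        + (ennreal (averaged_gap x z / c) + averaged_kernel x z * ennreal (1 / E))"
    using triple_lower_bound[OF assms(1) E] by metis
  \<comment> \<open>The constant \<open>c\<close> is fixed before the measure is chosen. An excess
    over the infimum below \<open>c / 6\<close> bounds \<open>H\<close>, and one below 1 bounds
    \<open>S\<close>.\<close>
  have "riesz_energy p K < ennreal (v + min 1 (c / 6))"
    using v c by (simp add: ennreal_less_iff)
  then obtain \<mu> where \<mu>: "\<mu> \<in> borel_prob_measures_on K"
    and lt: "(\<integral>\<^sup>+y. \<integral>\<^sup>+x. riesz_kernel p x y \<partial>\<mu> \<partial>\<mu>) < ennreal (v + min 1 (c / 6))"
    unfolding riesz_energy_def INF_less_iff by blast
  note \<mu>' = borel_prob_measures_onD[OF \<mu>]
  note [measurable] = \<mu>'(3)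
  interpret \<mu>: prob_space \<mu> by fact
  define H where "H = (\<integral>\<^sup>+y. \<integral>\<^sup>+x. ennreal (averaged_gap x y) \<partial>\<mu> \<partial>\<mu>)"
  define S where "S = (\<integral>\<^sup>+y. \<integral>\<^sup>+x. averaged_kernel x y \<partial>\<mu> \<partial>\<mu>)"
  have S: "S < ennreal (v + min 1 (c / 6))"
    unfolding S_def by (rule le_less_trans[OF averaged_energy_le[OF \<mu>] lt])
  have "ennreal v + H \<le> S"
    using energy_gap[OF \<mu>] by (simp add: H_def S_def eq v)
  then have H: "ennreal v + H < ennreal (v + min 1 (c / 6))" using S by (rule le_less_trans)
  define e where "e x y = ennreal (averaged_gap x y / c) + averaged_kernel x y * ennreal (1 / E)" for x y
  have [measurable]: "(\<lambda>w. e (a w) (b w)) \<in> borel_measurable Q"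
    if [measurable]: "a \<in> borel_measurable Q" "b \<in> borel_measurable Q" for a b :: "'z \<Rightarrow> real ^ 'n" and Q
    unfolding e_def by measurable
  define I where "I = (\<integral>\<^sup>+y. \<integral>\<^sup>+x. e x y \<partial>\<mu> \<partial>\<mu>)"
  have one: "emeasure \<mu> (space \<mu>) = 1" by (rule \<mu>.emeasure_space_1)
  \<comment> \<open>Integrating the triple bound over three independent copies of \<mu>: each pair
    contributes the same \<open>I\<close>, since the remaining variable has total mass 1. Hence 1
    \<le> 3 I, whereas I < 1/6 + 1/6.\<close>
  have "1 = (\<integral>\<^sup>+z. \<integral>\<^sup>+y. \<integral>\<^sup>+x. 1 \<partial>\<mu> \<partial>\<mu> \<partial>\<mu>)" by (simp add: one)
  also have "\<dots> \<le> (\<integral>\<^sup>+z. \<integral>\<^sup>+y. \<integral>\<^sup>+x. e x y + e y z + e x z \<partial>\<mu> \<partial>\<mu> \<partial>\<mu>)"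
    unfolding e_def using \<mu>'(2) by (intro nn_integral_mono lower) auto
  also have "\<dots> = I + I + I"
    by (simp add: nn_integral_add I_def one)
  finally have I3: "1 \<le> I + I + I" .
  have "I = (\<integral>\<^sup>+y. \<integral>\<^sup>+x. ennreal (averaged_gap x y) * ennreal (1 / c) + averaged_kernel x y * ennreal (1 / E) \<partial>\<mu> \<partial>\<mu>)"
    unfolding I_def e_def using c averaged_gap_nonneg by (simp flip: ennreal_mult)
  also have "\<dots> = H * ennreal (1 / c) + S * ennreal (1 / E)"
    unfolding H_def S_def by (simp add: nn_integral_add nn_integral_multc)
  finally have I: "I = H * ennreal (1 / c) + S * ennreal (1 / E)" .
  obtain s where s: "S = ennreal s" "s \<ge> 0" using S by (cases S) auto
  obtain r where r: "H = ennreal r" "r \<ge> 0" using H by (cases H) auto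
  have "s < v + 1" using S s v by (simp add: ennreal_less_iff)
  moreover have "r < c / 6" using H r v by (simp add: ennreal_less_iff flip: ennreal_plus)
  ultimately have "r / c < 1 / 6" "s / E < 1 / 6"
    using c E by (simp_all add: E_def field_simps)
  then have u: "r / c + s / E < 1 / 3" (is "?u < _") by linarith
  have u0: "0 \<le> ?u" using r s c E by simp
  have "I = ennreal ?u"
    using r s c E by (simp add: I ennreal_plus flip: ennreal_mult)
  then have "1 \<le> ennreal (?u + ?u + ?u)"
    using I3 u0 by (simp only: ennreal_plus add_nonneg_nonneg)
  then have "1 \<le> ?u + ?u + ?u"
    using u0 by (simp only: ennreal_ge_1)
  then show False using u by linarith
qed

lemma orthogonal_if_q_one:
  assumes "\<And>i. q i = 1" shows "orthogonal_matrix M"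
proof -
  have d: "d i = 1" for i
  proof -
    have "ln (sqrt (d i)) = 0"
      using assms[of i] d_pos[of i] p_pos ln_powr[of "sqrt (d i)" p] by (simp add: q_def)
    then have "sqrt (d i) = 1" using d_pos[of i] by simp
    then show ?thesis by simp
  qed
  have "norm (M *v z) = norm z" for z
  proof -
    have "(norm (M *v z))\<^sup>2 = (norm z)\<^sup>2" 
      using norm_M[of z] orthonormal_parseval[OF orthonormal, of z] by (simp add: d)
    then show ?thesis by simp
  qed
  then have "orthogonal_transformation ((*v) M)" by (simp add: orthogonal_transformation)
  then show ?thesis by (simp add: orthogonal_transformation_matrix)
qed

end

section \<open>Construction of the frames and passage from energies to capacities\<close>

lemma exists_singular_frame:
  fixes M :: "real ^ 'n ^ 'n"
  assumes "invertible M" "p > 0"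
  obtains f d where "singular_frame M f d p"
    "singular_values (matrix_inv M) = image_mset (\<lambda>i. sqrt (d i)) (mset_set UNIV)"
proof (rule inverse_singular_basis[OF assms(1)], goal_cases)
  case (1 f d)
  then show ?case
    using assms(2) by (intro that[of f d]) (unfold_locales, auto)
qed

lemma (in singular_frame) exists_averaged_frame:
  assumes "has_irreducible_isometry_group K" "compact K" and q_sum: "sum q UNIV = real CARD('n)"
  obtains F l where "averaged_frame M f d p K F l"
proof (rule design_quadratic_forms[OF assms(1,2) orthonormal, of q "\<lambda>i. (q i)\<^sup>2"], goal_cases)
  case (1 F l)
  then have "averaged_frame M f d p K F l"
    using assms(2) q_sum by unfold_locales auto
  then show ?case by (rule that)
qed

theorem theorem1p3:
  fixes K :: "(real ^ 'n) set" and M :: "real ^ 'n ^ 'n" and p :: real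
  assumes "CARD('n) \<ge> 2"
    and "0 < p" and "p < real CARD('n)"
    and "compact K" and "riesz_capacity p K > 0"
    and "invertible M" and "normalized_schatten_norm p (matrix_inv M) = 1"
    and "has_irreducible_isometry_group K"
  shows "riesz_capacity p ((\<lambda>x. M *v x) ` K) \<ge> riesz_capacity p K \<and>
         (riesz_capacity p ((\<lambda>x. M *v x) ` K) = riesz_capacity p K \<longleftrightarrow> orthogonal_matrix M)"
proof -
  obtain f d where "singular_frame M f d p"
    and sv: "singular_values (matrix_inv M) = image_mset (\<lambda>i. sqrt (d i)) (mset_set UNIV)"
    by (rule exists_singular_frame[OF assms(6,2)])
  then interpret singular_frame M f d p by simp
  have q_sum: "sum q UNIV = real CARD('n)"
  proof -
    define s where "s = 1 / real CARD('n) * sum q UNIV"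
    have "s \<ge> 0" unfolding s_def by (intro mult_nonneg_nonneg sum_nonneg) (auto simp: less_imp_le[OF q_pos])
    have "(\<Sum>\<sigma>\<in>#singular_values (matrix_inv M). \<sigma> powr p) = sum q UNIV"
      by (simp add: sv q_def multiset.map_comp comp_def flip: sum_unfold_sum_mset)
    then have "s powr (1 / p) = 1"
      using assms(7) by (simp add: normalized_schatten_norm_def s_def)
    \<comment> \<open>A vanishing \<open>s\<close> is excluded because \<open>0 powr (1 / p)\<close>
      is 0; for positive \<open>s\<close> the logarithm decides.\<close>
    then have "s = 1"
      using \<open>s \<ge> 0\<close> assms(2) ln_powr[of s "1 / p"] by (cases "s = 0") auto
    then show ?thesis by (simp add: s_def field_simps)
  qed
  obtain F l where "averaged_frame M f d p K F l"
    by (rule exists_averaged_frame[OF assms(8,4) q_sum])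
  then interpret averaged_frame M f d p K F l .
  let ?V = "riesz_energy p K" and ?V' = "riesz_energy p ((*v) M ` K)"
  have fin: "?V < \<infinity>"
    using assms(5) by (auto simp: riesz_capacity_def less_top split: if_splits)
  have le: "?V' \<le> ?V" by (rule riesz_energy_image_le)
  have "compact ((*v) M ` K)"
    using assms(4) by (intro compact_continuous_image continuous_on_matrix_vector_mult continuous_on_id)
  \<comment> \<open>With both energies positive and finite, the exponent -1/p reverses strict
    inequalities, so equality of capacities is equality of energies.\<close>
  then have pos: "?V' > 0" using assms(2) by (intro riesz_energy_pos compact_imp_bounded)
  obtain a b where ab: "?V = ennreal a" "?V' = ennreal b" "a \<ge> 0" "b \<ge> 0"
    using fin le_less_trans[OF le fin] by (cases ?V; cases ?V') auto
  have b: "0 < b" "b \<le> a" using pos le ab by auto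
  have cap: "riesz_capacity p K = a powr (- 1 / p)" "riesz_capacity p ((*v) M ` K) = b powr (- 1 / p)"
    using ab by (simp_all add: riesz_capacity_def)
  have cap_less: "a powr (- 1 / p) < b powr (- 1 / p)" if "b < a"
    using b that assms(2) by (intro powr_less_mono2_neg) auto
  have orth: "orthogonal_matrix M" if "b = a"
  proof (rule orthogonal_if_q_one, rule ccontr)
    fix i assume "q i \<noteq> 1"
    then have "?V' < ?V" using fin by (rule riesz_energy_image_less)
    then show False using that ab by simp
  qed
  have eq: "b = a" if "orthogonal_matrix M"
    using riesz_energy_orthogonal[OF that, of p K] ab by simp
  show ?thesis
    unfolding cap using b cap_less orth eq by (cases "b = a") force+
qed

end
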